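(* The generalized catenoid with parameters $t\in(-1,1)$ and $s\in\mathbb{R}\setminus\{0\}$ has the following properties: (1) It is embedded in $\mathbb{R}^4_1$. (2) There is a symmetry between its two ends: there is an isometry of $\mathbb{R}^4_1$ which interchanges the two ends and preserves the whole surface. (3) When $t\neq 0$, its symmetry group is finite. (4) Two generalized catenoids are congruent to each other (up to a dilation and a Lorentz isometry) if and only if their parameters $t$ have the same absolute value $|t|$. (5) When $t\ne0$, it is not contained in any $3$-dimensional subspace. Each end is embedded and asymptotic to a half catenoid in a $3$-dimensional Euclidean subspace.
   Context: $\mathbb{R}^4_1$ is $\mathbb{R}^4$ with $\langle \mathbf{x},\mathbf{x}\rangle=x_1^2+x_2^2+x_3^2-x_4^2$; a Lorentz isometry is an isometry of $\mathbb{R}^4_1$. The generalized catenoid with parameters $t\in(-1,1)$, $s\in\mathbb{R}\setminus\{0\}$ is the complete spacelike zero-mean-curvature surface $\mathbf{x}:\mathbb{C}\setminus\{0\}\to\mathbb{R}^4_1$, $$\mathbf{x}=2\,\mathrm{Re}\int(\phi+\psi,-\mathrm{i}(\phi-\psi),1-\phi\psi,1+\phi\psi)\,\mathrm{d}h,\quad \phi=z+t,\ \psi=\frac{-1}{z-t},\ \mathrm{d}h=s\frac{z-t}{z^2}\,\mathrm{d}z .$$ Up to a dilation and a translation (i.e. with $s=1$) it is $$\mathbf{x}=2\,\mathrm{Re}\Big(z+\tfrac{t^2+1}{z},\,-\mathrm{i}\big(z+\tfrac{t^2-1}{z}\big),\,2\ln z,\,\tfrac{2t}{z}\Big).$$ Its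 two ends are $z=0$ and $z=\infty$. For $t=0$ it is the classical catenoid in $\mathbb{R}^3$. The symmetry group is the group of isometries of $\mathbb{R}^4_1$ preserving the surface. A $3$-dimensional Euclidean subspace means a spacelike $3$-dimensional (affine) subspace. *)

theory Defs
  imports "HOL-Complex_Analysis.Complex_Analysis"
begin

definition lorentz_inner :: "real^4 \<Rightarrow> real^4 \<Rightarrow> real" where
  "lorentz_inner v w = v$1 * w$1 + v$2 * w$2 + v$3 * w$3 - v$4 * w$4"

text \<open>Isometries are not assumed to fix the origin; preservation of the indefinite squared
  distance already forces them to be affine.\<close>

definition lorentz_isometry :: "(real^4 \<Rightarrow> real^4) \<Rightarrow> bool" where
  "lorentz_isometry T \<longleftrightarrow> bij T \<and>
     (\<forall>v w. lorentz_inner (T v - T w) (T v - T w) = lorentz_inner (v - w) (v - w))"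

definition symmetry_group :: "(real^4) set \<Rightarrow> (real^4 \<Rightarrow> real^4) set" where
  "symmetry_group S = {T. lorentz_isometry T \<and> T ` S = S}"

definition congruent_up_to_dilation :: "(real^4) set \<Rightarrow> (real^4) set \<Rightarrow> bool" where
  "congruent_up_to_dilation S S' \<longleftrightarrow>
     (\<exists>T c. lorentz_isometry T \<and> c > 0 \<and> S' = T ` ((\<lambda>v. c *\<^sub>R v) ` S))"

definition euclidean_3_subspace :: "(real^4) set \<Rightarrow> bool" where
  "euclidean_3_subspace E \<longleftrightarrow> affine E \<and> aff_dim E = 3 \<and>
     (\<forall>p\<in>E. \<forall>q\<in>E. p \<noteq> q \<longrightarrow> lorentz_inner (p - q) (p - q) > 0)"

text \<open>The Weierstrass data and the vector-valued one-form (coefficient of \<open>dz\<close>). As \<open>\<psi>\<close> has a pole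
  at \<open>t\<close>, the formula has its intended value only off \<open>{0, t}\<close>; the form itself
  extends holomorphically to \<open>t\<close> when \<open>t \<noteq> 0\<close>.\<close>

definition gc_phi :: "real \<Rightarrow> complex \<Rightarrow> complex" where
  "gc_phi t z = z + of_real t"

definition gc_psi :: "real \<Rightarrow> complex \<Rightarrow> complex" where
  "gc_psi t z = -1 / (z - of_real t)"

definition gc_dh :: "real \<Rightarrow> real \<Rightarrow> complex \<Rightarrow> complex" where
  "gc_dh t s z = of_real s * (z - of_real t) / z\<^sup>2"

definition gc_form :: "real \<Rightarrow> real \<Rightarrow> complex \<Rightarrow> complex^4" where
  "gc_form t s z = vector
     [(gc_phi t z + gc_psi t z) * gc_dh t s z,
      - \<i> * (gc_phi t z - gc_psi t z) * gc_dh t s z,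
      (1 - gc_phi t z * gc_psi t z) * gc_dh t s z,
      (1 + gc_phi t z * gc_psi t z) * gc_dh t s z]"

text \<open>\<open>x = 2 Re \<integral> gc_form\<close> on the punctured plane. The indefinite integral determines \<open>x\<close>
  up to a translation, so this is a predicate; the values of \<open>x\<close> at \<open>0\<close> are irrelevant,
  and continuity takes care of the removable point \<open>t\<close>.\<close>

definition generalized_catenoid :: "real \<Rightarrow> real \<Rightarrow> (complex \<Rightarrow> real^4) \<Rightarrow> bool" where
  "generalized_catenoid t s x \<longleftrightarrow> continuous_on (- {0}) x \<and>
     (\<forall>g. valid_path g \<and> path_image g \<subseteq> - {0, of_real t} \<longrightarrow>
        (\<forall>j. x (pathfinish g) $ j - x (pathstart g) $ j =
              2 * Re (contour_integral g (\<lambda>z. gc_form t s z $ j))))"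

abbreviation surface :: "(complex \<Rightarrow> real^4) \<Rightarrow> (real^4) set" where
  "surface x \<equiv> x ` (- {0})"

primrec Ck_on :: "nat \<Rightarrow> complex set \<Rightarrow> (complex \<Rightarrow> 'b::real_normed_vector) \<Rightarrow> bool" where
  "Ck_on 0 U f \<longleftrightarrow> continuous_on U f"
| "Ck_on (Suc k) U f \<longleftrightarrow>
     (\<exists>f1 f2. (\<forall>z\<in>U. (f has_derivative (\<lambda>v. Re v *\<^sub>R f1 z + Im v *\<^sub>R f2 z)) (at z)) \<and>
              Ck_on k U f1 \<and> Ck_on k U f2)"

definition smooth_embedding :: "complex set \<Rightarrow> (complex \<Rightarrow> real^4) \<Rightarrow> bool" where
  "smooth_embedding U f \<longleftrightarrow> open U \<and> (\<forall>k. Ck_on k U f) \<and>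
     (\<forall>z\<in>U. inj (frechet_derivative f (at z))) \<and>
     (\<exists>g. homeomorphism U (f ` U) f g)"

text \<open>The two ends are represented by the filters \<open>at 0\<close> and \<open>at_infinity\<close> on the parameter
  domain.\<close>

definition end_neighbourhood :: "complex filter \<Rightarrow> complex set \<Rightarrow> bool" where
  "end_neighbourhood F W \<longleftrightarrow> open W \<and> 0 \<notin> W \<and> eventually (\<lambda>z. z \<in> W) F"

definition interchanges_ends :: "(complex \<Rightarrow> real^4) \<Rightarrow> (real^4 \<Rightarrow> real^4) \<Rightarrow> bool" where
  "interchanges_ends x T \<longleftrightarrow>
     (\<exists>\<sigma>. bij_betw \<sigma> (- {0}) (- {0}) \<and> (\<forall>z\<in>- {0}. T (x z) = x (\<sigma> z)) \<and>
          filterlim \<sigma> at_infinity (at 0) \<and> filterlim \<sigma> (at 0) at_infinity)"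

text \<open>A catenoid in \<open>E\<close> is traced out by a Lorentz-orthonormal frame \<open>e1, e2, e3\<close> of \<open>E\<close> with centre
  \<open>p\<close>, axis \<open>e3\<close> and scale \<open>c\<close>; a half catenoid is the part on one side of the waist circle
  \<open>v = 0\<close>.\<close>

definition half_catenoid_in :: "(real^4) set \<Rightarrow> (real^4) set \<Rightarrow> bool" where
  "half_catenoid_in E H \<longleftrightarrow>
     (\<exists>p e1 e2 e3 c. c > 0 \<and> {p, p + e1, p + e2, p + e3} \<subseteq> E \<and>
        lorentz_inner e1 e1 = 1 \<and> lorentz_inner e2 e2 = 1 \<and> lorentz_inner e3 e3 = 1 \<and>
        lorentz_inner e1 e2 = 0 \<and> lorentz_inner e1 e3 = 0 \<and> lorentz_inner e2 e3 = 0 \<and>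
        H = {p + c *\<^sub>R ((cosh v * cos u) *\<^sub>R e1 + (cosh v * sin u) *\<^sub>R e2 + v *\<^sub>R e3) | u v.
               v > 0})"

text \<open>The end \<open>F\<close> of \<open>x\<close> is asymptotic to \<open>H\<close>: a neighbourhood of the end can be identified with
  \<open>H\<close> by a diffeomorphism \<open>y\<close> so that corresponding points approach each other.\<close>

definition end_asymptotic_to :: "complex filter \<Rightarrow> (complex \<Rightarrow> real^4) \<Rightarrow> (real^4) set \<Rightarrow> bool" where
  "end_asymptotic_to F x H \<longleftrightarrow>
     (\<exists>W y. end_neighbourhood F W \<and> smooth_embedding W y \<and> y ` W = H \<and>
            ((\<lambda>z. x z - y z) \<longlongrightarrow> 0) F)"

text \<open>The closed form satisfies the predicate, for all parameters.\<close>

lemma vector_4_nth [simp]: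
  "(vector [a, b, c, d] :: 'a::zero^4) $ 1 = a"
  "(vector [a, b, c, d] :: 'a::zero^4) $ 2 = b"
  "(vector [a, b, c, d] :: 'a::zero^4) $ 3 = c"
  "(vector [a, b, c, d] :: 'a::zero^4) $ 4 = d"
  unfolding vector_def by auto

definition gc_closed_form :: "real \<Rightarrow> complex \<Rightarrow> real^4" where
  "gc_closed_form t z = 2 *\<^sub>R vector
     [Re (z + (of_real t ^ 2 + 1) / z),
      Re (- \<i> * (z + (of_real t ^ 2 - 1) / z)),
      2 * ln (norm z),
      Re (2 * of_real t / z)]"

lemma gc_form_eq:
  assumes "z \<noteq> 0" "z \<noteq> of_real t"
  shows "gc_form t s z = vector
    [of_real s * (1 - (of_real t ^ 2 + 1) / z\<^sup>2),
     of_real s * (- \<i> * (1 - (of_real t ^ 2 - 1) / z\<^sup>2)),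
     of_real s * 2 * (1 / z),
     of_real s * (- 2 * of_real t / z\<^sup>2)]"
  using assms
  by (simp add: vec_eq_iff forall_4 gc_form_def gc_phi_def gc_psi_def gc_dh_def
      divide_simps power2_eq_square) (auto simp: algebra_simps)

lemma generalized_catenoid_closed_form:
  "generalized_catenoid t s (\<lambda>z. s *\<^sub>R gc_closed_form t z + b)"
proof -
  have cont: "continuous_on (- {0}) (\<lambda>z. s *\<^sub>R gc_closed_form t z + b)"
  proof -
    have "continuous_on (- {0}) (\<lambda>z. (s *\<^sub>R gc_closed_form t z + b) $ j)" for j
      using exhaust_4[of j]
      by (elim disjE; simp only: vector_add_component vector_scaleR_component
            gc_closed_form_def vector_4_nth; intro continuous_intros; auto)
    then show ?thesis
      using continuous_on_vec_lambda[of "- {0}" "\<lambda>j z. (s *\<^sub>R gc_closed_form t z + b) $ j"]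
      by (simp only: vec_lambda_eta)
  qed
  have "(s *\<^sub>R gc_closed_form t (pathfinish g) + b) $ j
          - (s *\<^sub>R gc_closed_form t (pathstart g) + b) $ j
        = 2 * Re (contour_integral g (\<lambda>z. gc_form t s z $ j))"
    if g: "valid_path g" and im: "path_image g \<subseteq> - {0, of_real t}" for g j
  proof -
    let ?S = "- {0, complex_of_real t}"
    let ?a = "pathstart g" and ?b = "pathfinish g"
    have ends: "?a \<noteq> 0" "?b \<noteq> 0"
      using im pathstart_in_path_image[of g] pathfinish_in_path_image[of g] by auto
    have eqI: "contour_integral g (\<lambda>z. gc_form t s z $ j) = contour_integral g f"
      if "\<And>z. z \<in> ?S \<Longrightarrow> gc_form t s z $ j = f z" for f
      by (rule contour_integral_eq) (use im that in blast)
    have prim: ?thesis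
      if F: "\<And>z. z \<in> ?S \<Longrightarrow> (F has_field_derivative (gc_form t s z $ j)) (at z)"
        and re: "\<And>z. s * gc_closed_form t z $ j = 2 * Re (F z)" for F
    proof -
      have "contour_integral g (\<lambda>z. gc_form t s z $ j) = F ?b - F ?a"
        by (rule contour_integral_unique, rule contour_integral_primitive[OF _ g im])
           (use F has_field_derivative_at_within in blast)
      then show ?thesis by (simp add: re)
    qed
    consider "j = 1" | "j = 2" | "j = 3" | "j = 4" using exhaust_4 by blast
    then show ?thesis
    proof cases
      case 1
      show ?thesis
      proof (rule prim[of "\<lambda>z. of_real s * (z + (of_real t ^ 2 + 1) / z)"])
        show "((\<lambda>z. of_real s * (z + (of_real t ^ 2 + 1) / z)) has_field_derivative gc_form t s z $ j) (at z)"
          if "z \<in> ?S" for z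
          unfolding 1 using that
          by (auto simp: gc_form_eq power2_eq_square intro!: derivative_eq_intros) (auto simp: field_simps)
        show "s * gc_closed_form t z $ j = 2 * Re (of_real s * (z + (of_real t ^ 2 + 1) / z))" for z
          by (simp add: 1 gc_closed_form_def)
      qed
    next
      case 2
      show ?thesis
      proof (rule prim[of "\<lambda>z. of_real s * (- \<i> * (z + (of_real t ^ 2 - 1) / z))"])
        show "((\<lambda>z. of_real s * (- \<i> * (z + (of_real t ^ 2 - 1) / z))) has_field_derivative gc_form t s z $ j) (at z)"
          if "z \<in> ?S" for z
          unfolding 2 using that
          by (auto simp: gc_form_eq power2_eq_square intro!: derivative_eq_intros) (auto simp: field_simps)
        show "s * gc_closed_form t z $ j = 2 * Re (of_real s * (- \<i> * (z + (of_real t ^ 2 - 1) / z)))" for z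
          by (simp add: 2 gc_closed_form_def) (simp add: algebra_simps)
      qed
    next
      case 3
      have 0: "0 \<notin> path_image g" using im by auto
      let ?I = "contour_integral g (\<lambda>w. 1 / (w - 0))"
      have "exp (- ?I) * ?b = ?a"
        using winding_number_exp_integral(2)[of g 0 1 0] g 0
        by (simp add: valid_path_def path_defs contour_integral_integral)
      then have "norm ?a = exp (- Re ?I) * norm ?b"
        by (metis norm_exp_eq_Re norm_mult uminus_complex.sel(1))
      then have "ln (norm ?b) = ln (norm ?a) + Re ?I"
        using ends by (simp add: ln_mult)
      moreover have "contour_integral g (\<lambda>z. gc_form t s z $ j)
          = contour_integral g (\<lambda>z. (of_real s * 2) * (1 / (z - 0)))"
        by (rule eqI) (simp add: 3 gc_form_eq)
      moreover have "\<dots> = (of_real s * 2) * ?I"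
        by (rule contour_integral_lmul)
           (rule contour_integrable_inversediff[OF g 0])
      ultimately show ?thesis by (simp add: 3 gc_closed_form_def algebra_simps)
    next
      case 4
      show ?thesis
      proof (rule prim[of "\<lambda>z. of_real s * (2 * of_real t / z)"])
        show "((\<lambda>z. of_real s * (2 * of_real t / z)) has_field_derivative gc_form t s z $ j) (at z)"
          if "z \<in> ?S" for z
          unfolding 4 using that
          by (auto simp: gc_form_eq power2_eq_square intro!: derivative_eq_intros)
        show "s * gc_closed_form t z $ j = 2 * Re (of_real s * (2 * of_real t / z))" for z
          by (simp add: 4 gc_closed_form_def del: times_divide_eq_right)
      qed
    qed
  qed
  with cont show ?thesis unfolding generalized_catenoid_def by blast
qed

end

theory Submission
  imports Defs "HOL-Real_Asymp.Real_Asymp"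
begin

text \<open>Up to translation a generalized catenoid is \<open>s\<close> times the explicit surface with coordinates
  \<open>2 Re z + 2 (1 + t\<^sup>2) Re z / |z|\<^sup>2\<close>, \<open>2 Im z + 2 (1 - t\<^sup>2) Im z / |z|\<^sup>2\<close>, \<open>4 ln |z|\<close> and \<open>4 t Re z / |z|\<^sup>2\<close>.
  The height determines \<open>|z|\<close>, and then the first two coordinates determine \<open>z\<close>. This gives an explicit
  smooth left inverse, hence an embedding (\<open>smooth_embedding_annular_catenoid\<close>).

  The inversion \<open>z \<mapsto> (1 - t\<^sup>2) / cnj z\<close> of the parameter is induced by an isometry of space: it exchanges
  the leading terms at \<open>0\<close> and at \<open>\<infinity>\<close>, which span planes related by a hyperbolic reflection
  (\<open>ends_exchange_symmetry\<close>). Up to terms that vanish at an end the surface is a classical half catenoid there,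
  in the coordinate hyperplane at \<open>\<infinity>\<close> and in a boosted copy of it at \<open>0\<close>
  (\<open>end_at_infinity_asymptotic\<close>, \<open>end_at_zero_asymptotic\<close>).

  The rigidity statements rest on the asymptotic cone, the set of limits of points of the surface
  rescaled to the origin. For a generalized catenoid it consists of the planes of the two ends
  (\<open>asymptotic_cone_surface\<close>). For \<open>t \<noteq> 0\<close> these are distinct, meet in a spacelike line, and enclose a
  hyperbolic angle whose hyperbolic cosine is \<open>(1 + t\<^sup>2) / (1 - t\<^sup>2)\<close>. Isometries of the surface are affine, and their
  linear parts, like those of congruences, respect the cones. A congruence therefore preserves the angle and with
  it \<open>|t|\<close> (\<open>end_planes_angle_injective\<close>). A symmetry permutes finitely many unit vectors that are attached
  to the cone and span space, so only finitely many linear parts occur; the linear part determines the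
  symmetry because no nonzero translation preserves the surface (\<open>finite_symmetry_group\<close>).\<close>

(* Coefficients of power series would share the infix sign of vector components. *)
no_notation fps_nth (infixl "$" 75)

section \<open>Closed form\<close>

lemma vec4_eqI:
  fixes v w :: "'a^4"
  assumes "v $ 1 = w $ 1" "v $ 2 = w $ 2" "v $ 3 = w $ 3" "v $ 4 = w $ 4"
  shows "v = w"
  using assms by (simp add: vec_eq_iff forall_4)

lemma one_plus_square_pos: "0 < 1 + (t::real)\<^sup>2"
  by (simp add: add_pos_nonneg)

lemma one_minus_square_pos: "-1 < t \<Longrightarrow> t < 1 \<Longrightarrow> 0 < 1 - (t::real)\<^sup>2"
  using abs_square_less_1[of t] by (auto simp: abs_less_iff)

text \<open>The two fractions are the hyperbolic cosine and sine of the boost that tilts the plane of one end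
  against the plane of the other.\<close>

lemma boost_identity:
  fixes t :: real
  assumes "-1 < t" "t < 1"
  shows "((1 + t\<^sup>2) / (1 - t\<^sup>2))\<^sup>2 - (2 * t / (1 - t\<^sup>2))\<^sup>2 = 1"
proof -
  have "(1 + t\<^sup>2)\<^sup>2 - (2 * t)\<^sup>2 = (1 - t\<^sup>2)\<^sup>2"
    by (simp add: power2_eq_square algebra_simps)
  then show ?thesis
    using one_minus_square_pos[OF assms]
    by (simp only: power_divide diff_divide_distrib[symmetric]) simp
qed

text \<open>The defining condition fixes all increments along paths that avoid \<open>0\<close> and \<open>t\<close>, and the plane
  without these two points is connected. Hence the explicit surface of the definitions is the only
  one up to translation, and everything below can be computed from it.\<close>

lemma generalized_catenoid_unique:
  assumes x: "generalized_catenoid t s x" and y: "generalized_catenoid t s y"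
  obtains b where "\<And>z. z \<noteq> 0 \<Longrightarrow> x z = y z + b"
proof -
  define U where "U = - {0, complex_of_real t}"
  have "open U" "connected U"
    using connected_open_delete_finite[of UNIV "{0, complex_of_real t}"]
    by (auto simp: U_def Compl_eq_Diff_UNIV intro: finite_imp_closed)
  have "infinite U"
    by (simp add: U_def infinite_UNIV_char_0 Compl_eq_Diff_UNIV Diff_infinite_finite)
  then obtain z0 where z0: "z0 \<in> U"
    using infinite_imp_nonempty by blast
  define b where "b = x z0 - y z0"
  have eqU: "x z = y z + b" if "z \<in> U" for z
  proof -
    obtain g where g: "polynomial_function g" "path_image g \<subseteq> U" "pathstart g = z0" "pathfinish g = z"
      using connected_open_polynomial_connected[OF \<open>open U\<close> \<open>connected U\<close> z0 \<open>z \<in> U\<close>] by blast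
    from g(1) have "valid_path g" by (rule valid_path_polynomial_function)
    then have "x z $ j - x z0 $ j = y z $ j - y z0 $ j" for j
      using x y g(2-4) unfolding generalized_catenoid_def U_def by metis
    then show ?thesis by (simp add: vec_eq_iff b_def algebra_simps)
  qed
  have "x z = y z + b" if "z \<noteq> 0" for z
  proof (cases "z = of_real t")
    case True
    \<comment> \<open>The puncture at \<open>t\<close> is filled in by continuity.\<close>
    have "((\<lambda>w. x w - y w) \<longlongrightarrow> x z - y z) (at z)"
      using x y that unfolding generalized_catenoid_def
      by (intro tendsto_diff) (auto simp: continuous_on_eq_continuous_at open_Compl isCont_def)
    moreover have "((\<lambda>w. x w - y w) \<longlongrightarrow> b) (at z)"
    proof (rule tendsto_eventually)
      have "\<forall>\<^sub>F w in at z. w \<noteq> 0 \<and> w \<noteq> z"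
        using that by (intro eventually_conj eventually_neq_at_within)
      then show "\<forall>\<^sub>F w in at z. x w - y w = b"
        by eventually_elim (auto simp: eqU U_def True)
    qed
    ultimately have "x z - y z = b" by (rule tendsto_unique[OF trivial_limit_at])
    then show ?thesis by (simp add: algebra_simps)
  qed (use that eqU in \<open>auto simp: U_def\<close>)
  then show thesis by (rule that)
qed

lemma generalized_catenoid_imp_closed_form:
  assumes "generalized_catenoid t s x"
  shows "\<exists>b. \<forall>z. z \<noteq> 0 \<longrightarrow> x z = s *\<^sub>R gc_closed_form t z + b"
proof (rule generalized_catenoid_unique[OF assms generalized_catenoid_closed_form[of t s 0]])
  fix b assume "\<And>z. z \<noteq> 0 \<Longrightarrow> x z = s *\<^sub>R gc_closed_form t z + 0 + b"
  then show ?thesis by (intro exI[of _ b]) simp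
qed

text \<open>Maps whose horizontal level curves are ellipses, with the logarithm as height. The family
  contains the generalized catenoids themselves and also the half catenoids to which their ends are
  asymptotic, so that embeddedness and limits have to be established only once.\<close>

definition annular_catenoid ::
    "real \<Rightarrow> real \<Rightarrow> real \<Rightarrow> real \<Rightarrow> real \<Rightarrow> real \<Rightarrow> complex \<Rightarrow> real^4" where
  "annular_catenoid a a' c c' d d' z = vector
     [a * Re z + a' * Re z / (norm z)\<^sup>2,
      c * Im z + c' * Im z / (norm z)\<^sup>2,
      4 * ln (norm z),
      d * Re z + d' * Re z / (norm z)\<^sup>2]"

lemma gc_closed_form_annular:
  "gc_closed_form t z = annular_catenoid 2 (2 * (1 + t\<^sup>2)) 2 (2 * (1 - t\<^sup>2)) 0 (4 * t) z"
proof -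
  have "1 + (complex_of_real t)\<^sup>2 = of_real (1 + t\<^sup>2)" "(complex_of_real t)\<^sup>2 - 1 = of_real (t\<^sup>2 - 1)"
    by auto
  then show ?thesis
    by (intro vec4_eqI) (simp_all add: gc_closed_form_def annular_catenoid_def Re_divide Im_divide
      cmod_power2 add.commute left_diff_distrib flip: of_real_power; simp add: field_simps)+
qed

lemma gc_closed_form_nth:
  "gc_closed_form t z $ 1 = 2 * Re z + 2 * (1 + t\<^sup>2) * Re z / (norm z)\<^sup>2"
  "gc_closed_form t z $ 2 = 2 * Im z + 2 * (1 - t\<^sup>2) * Im z / (norm z)\<^sup>2"
  "gc_closed_form t z $ 3 = 4 * ln (norm z)"
  "gc_closed_form t z $ 4 = 4 * t * Re z / (norm z)\<^sup>2"
  by (simp_all add: gc_closed_form_annular annular_catenoid_def)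

section \<open>Smooth embedding\<close>

lemma Ck_on_SucI:
  assumes "\<And>z. z \<in> U \<Longrightarrow> (f has_derivative (\<lambda>v. Re v *\<^sub>R f1 z + Im v *\<^sub>R f2 z)) (at z)"
    and "Ck_on k U f1" "Ck_on k U f2"
  shows "Ck_on (Suc k) U f"
  using assms by auto

text \<open>Real parts of holomorphic functions stay in this class under partial differentiation, the two
  partial derivatives of \<open>Re \<Phi>\<close> being \<open>Re \<Phi>'\<close> and \<open>Re (\<i> \<Phi>')\<close>; this makes the induction on the order of
  differentiability work.\<close>

lemma Ck_on_Re_holomorphic:
  fixes \<Phi> :: "4 \<Rightarrow> complex \<Rightarrow> complex"
  assumes "open U" "\<And>j. \<Phi> j holomorphic_on U"
  shows "Ck_on k U (\<lambda>z. (\<chi> j. Re (\<Phi> j z)) :: real^4)"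
  using assms(2)
proof (induction k arbitrary: \<Phi>)
  case 0
  then show ?case
    by (auto intro!: continuous_intros holomorphic_on_imp_continuous_on)
next
  case (Suc k)
  let ?f1 = "\<lambda>z. (\<chi> j. Re (deriv (\<Phi> j) z)) :: real^4"
  let ?f2 = "\<lambda>z. (\<chi> j. Re (\<i> * deriv (\<Phi> j) z)) :: real^4"
  have hol: "deriv (\<Phi> j) holomorphic_on U" for j
    using Suc.prems \<open>open U\<close> by (rule holomorphic_deriv)
  have "((\<lambda>z. (\<chi> j. Re (\<Phi> j z)) :: real^4) has_derivative
           (\<lambda>v. Re v *\<^sub>R ?f1 z + Im v *\<^sub>R ?f2 z)) (at z)" if "z \<in> U" for z
  proof -
    have "((\<lambda>w. Re (\<Phi> j w)) has_derivative (\<lambda>v. Re (deriv (\<Phi> j) z * v))) (at z)" for j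
      using holomorphic_derivI[OF Suc.prems \<open>open U\<close> that]
      by (intro has_derivative_Re) (simp add: has_field_derivative_def)
    then show ?thesis
      by (subst has_derivative_componentwise_within)
         (auto simp: Basis_vec_def inner_axis mult.commute algebra_simps)
  qed
  moreover have "Ck_on k U ?f1" using Suc.IH[of "\<lambda>j. deriv (\<Phi> j)"] hol by blast
  moreover have "Ck_on k U ?f2"
    by (intro Suc.IH holomorphic_intros hol)
  ultimately show ?case by (rule Ck_on_SucI)
qed

text \<open>It suffices to control the derivative, which avoids a holomorphic primitive: the logarithmic
  height has a holomorphic derivative but is not globally the real part of a holomorphic function.
  A differentiable left inverse yields injectivity, the immersion property and the topological
  embedding together.\<close>

lemma smooth_embeddingI:
  fixes f :: "complex \<Rightarrow> real^4" and \<Phi> :: "4 \<Rightarrow> complex \<Rightarrow> complex"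
  assumes "open U" and hol: "\<And>j. \<Phi> j holomorphic_on U"
    and f: "\<And>z. z \<in> U \<Longrightarrow> (f has_derivative (\<lambda>v. \<chi> j. Re (\<Phi> j z * v))) (at z)"
    and g: "\<And>z. z \<in> U \<Longrightarrow> g differentiable (at (f z))"
    and gf: "\<And>z. z \<in> U \<Longrightarrow> g (f z) = z"
  shows "smooth_embedding U f"
proof -
  have contf: "continuous_on U f"
    using f by (meson continuous_at_imp_continuous_on has_derivative_continuous)
  have "Ck_on k U f" for k
  proof (cases k)
    case (Suc m)
    let ?f1 = "\<lambda>z. (\<chi> j. Re (\<Phi> j z)) :: real^4"
    let ?f2 = "\<lambda>z. (\<chi> j. Re (\<i> * \<Phi> j z)) :: real^4"
    have "(f has_derivative (\<lambda>v. Re v *\<^sub>R ?f1 z + Im v *\<^sub>R ?f2 z)) (at z)" if "z \<in> U" for z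
    proof -
      have "(\<lambda>v. Re v *\<^sub>R ?f1 z + Im v *\<^sub>R ?f2 z) = (\<lambda>v. \<chi> j. Re (\<Phi> j z * v))"
        by (auto simp: fun_eq_iff vec_eq_iff algebra_simps)
      with f[OF that] show ?thesis by simp
    qed
    moreover have "Ck_on m U ?f1" "Ck_on m U ?f2"
      by (intro Ck_on_Re_holomorphic \<open>open U\<close> holomorphic_intros hol)+
    ultimately show ?thesis unfolding Suc by (rule Ck_on_SucI)
  qed (use contf in simp)
  moreover have "inj (frechet_derivative f (at z))" if z: "z \<in> U" for z
  proof -
    \<comment> \<open>By the chain rule the derivative of \<open>g\<close> is a left inverse of the derivative of \<open>f\<close>.\<close>
    obtain g' where g': "(g has_derivative g') (at (f z))"
      using g[OF z] by (auto simp: differentiable_def)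
    define f' where "f' = frechet_derivative f (at z)"
    have f': "(f has_derivative f') (at z)"
      using f[OF z] frechet_derivative_works differentiable_def f'_def by blast
    have "(g \<circ> f has_derivative g' \<circ> f') (at z)"
      using f' g' by (rule diff_chain_at)
    then have "((\<lambda>w. w) has_derivative g' \<circ> f') (at z)"
      by (rule has_derivative_transform_within_open[OF _ \<open>open U\<close> z]) (simp add: gf)
    then have "g' \<circ> f' = (\<lambda>w. w)"
      using has_derivative_unique has_derivative_ident by blast
    then show ?thesis unfolding f'_def[symmetric]
      by (metis (no_types, lifting) comp_apply injI)
  qed
  moreover have "homeomorphism U (f ` U) f g"
  proof -
    have "continuous_on (f ` U) g"
      using g differentiable_imp_continuous_within
      by (auto intro!: continuous_at_imp_continuous_on)
    then show ?thesis using contf gf by (auto simp: homeomorphism_def image_iff)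
  qed
  ultimately show ?thesis using \<open>open U\<close> unfolding smooth_embedding_def by blast
qed

text \<open>The height determines \<open>|z|\<close>, after which the first two coordinates are positive multiples of
  \<open>Re z\<close> and \<open>Im z\<close>, the factors depending on \<open>|z|\<close> alone. So the left inverse is explicit and smooth,
  even on all of the target space.\<close>

lemma smooth_embedding_annular_catenoid:
  assumes pos: "a > 0" "a' > 0" "c > 0" "c' > 0" and "s \<noteq> 0"
    and U: "open U" "0 \<notin> U"
    and f: "\<And>z. z \<in> U \<Longrightarrow> f z = s *\<^sub>R annular_catenoid a a' c c' d d' z + b"
  shows "smooth_embedding U f"
proof -
  define \<Phi> :: "4 \<Rightarrow> complex \<Rightarrow> complex" where "\<Phi> j = (\<lambda>z. of_real s * ((vector
     [of_real a - of_real a' / z\<^sup>2, - \<i> * (of_real c + of_real c' / z\<^sup>2), 4 / z,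
      of_real d - of_real d' / z\<^sup>2] :: complex^4) $ j))" for j
  define \<rho> where "\<rho> v = exp (((v - b) $ 3 / s) / 2)" for v :: "real^4"
  define g where "g v = Complex ((v - b) $ 1 / s / (a + a' / \<rho> v)) ((v - b) $ 2 / s / (c + c' / \<rho> v))"
    for v :: "real^4"
  have hol: "\<Phi> j holomorphic_on U" for j
    using exhaust_4[of j] U
    by (elim disjE; simp only: \<Phi>_def vector_4_nth; intro holomorphic_intros; auto)
  have "(f has_derivative (\<lambda>v. \<chi> j. Re (\<Phi> j z * v))) (at z)" if z: "z \<in> U" for z
  proof -
    have "z \<noteq> 0" using z U by auto
    let ?h = "\<lambda>z. s *\<^sub>R annular_catenoid a a' c c' d d' z + b"
    have re: "((\<lambda>w. \<alpha> * Re w + \<beta> * Re w / (norm w)\<^sup>2) has_derivative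
         (\<lambda>v. Re ((of_real \<alpha> - of_real \<beta> / z\<^sup>2) * v))) (at z)" for \<alpha> \<beta> :: real
    proof -
      have "((\<lambda>w. of_real \<alpha> * w + of_real \<beta> / w) has_field_derivative
          (of_real \<alpha> - of_real \<beta> / z\<^sup>2)) (at z)"
        using \<open>z \<noteq> 0\<close> by (auto intro!: derivative_eq_intros simp: power2_eq_square)
      then have "((\<lambda>w. Re (of_real \<alpha> * w + of_real \<beta> / w)) has_derivative
          (\<lambda>v. Re ((of_real \<alpha> - of_real \<beta> / z\<^sup>2) * v))) (at z)"
        unfolding has_field_derivative_def by (rule has_derivative_Re)
      moreover have "Re (of_real \<alpha> * w + of_real \<beta> / w) = \<alpha> * Re w + \<beta> * Re w / (norm w)\<^sup>2" for w
        by (simp add: Re_divide cmod_power2)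
      ultimately show ?thesis by (simp only:)
    qed
    have im: "((\<lambda>w. \<alpha> * Im w + \<beta> * Im w / (norm w)\<^sup>2) has_derivative
         (\<lambda>v. Re ((- \<i> * (of_real \<alpha> + of_real \<beta> / z\<^sup>2)) * v))) (at z)" for \<alpha> \<beta> :: real
    proof -
      have "((\<lambda>w. - \<i> * (of_real \<alpha> * w - of_real \<beta> / w)) has_field_derivative
          (- \<i> * (of_real \<alpha> + of_real \<beta> / z\<^sup>2))) (at z)"
        using \<open>z \<noteq> 0\<close> by (auto intro!: derivative_eq_intros simp: power2_eq_square)
      then have "((\<lambda>w. Re (- \<i> * (of_real \<alpha> * w - of_real \<beta> / w))) has_derivative
          (\<lambda>v. Re (- \<i> * (of_real \<alpha> + of_real \<beta> / z\<^sup>2) * v))) (at z)"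
        unfolding has_field_derivative_def by (rule has_derivative_Re)
      moreover have "Re (- \<i> * (of_real \<alpha> * w - of_real \<beta> / w)) = \<alpha> * Im w + \<beta> * Im w / (norm w)\<^sup>2" for w
        by (simp add: Im_divide cmod_power2)
      ultimately show ?thesis by (simp only:)
    qed
    have ln: "((\<lambda>w. 4 * ln (norm w)) has_derivative (\<lambda>v. Re (4 / z * v))) (at z)"
    proof -
      have "((\<lambda>w. 4 * ln (norm w)) has_derivative (\<lambda>v. 4 * ((v \<bullet> sgn z) * inverse (norm z)))) (at z)"
        using \<open>z \<noteq> 0\<close> by (auto intro!: derivative_eq_intros has_derivative_norm)
      moreover have "4 * ((v \<bullet> sgn z) * inverse (norm z)) = Re (4 / z * v)" for v
        using \<open>z \<noteq> 0\<close> by (simp add: inner_complex_def sgn_div_norm Re_divide Im_divide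
           flip: cmod_power2) (simp add: power2_eq_square field_simps)
      ultimately show ?thesis by simp
    qed
    have "((\<lambda>w. ?h w $ j) has_derivative (\<lambda>v. Re (\<Phi> j z * v))) (at z)" for j
    proof -
      have "((\<lambda>w. annular_catenoid a a' c c' d d' w $ j) has_derivative
           (\<lambda>v. Re ((\<Phi> j z / of_real s) * v))) (at z)"
        using exhaust_4[of j] re[of a a'] im[of c c'] ln re[of d d'] \<open>s \<noteq> 0\<close>
        by (elim disjE) (simp_all only: \<Phi>_def annular_catenoid_def vector_4_nth
          nonzero_mult_div_cancel_left of_real_eq_0_iff not_False_eq_True)
      from has_derivative_scaleR_right[OF this, of s]
      have "((\<lambda>w. s * annular_catenoid a a' c c' d d' w $ j) has_derivative
           (\<lambda>v. s * Re (\<Phi> j z / of_real s * v))) (at z)"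
        by (simp only: real_scaleR_def)
      moreover have "s * Re (\<Phi> j z / of_real s * v) = Re (\<Phi> j z * v)" for v
        using \<open>s \<noteq> 0\<close>
        by (simp only: times_divide_eq_left Re_divide_of_real) simp
      ultimately have "((\<lambda>w. s * annular_catenoid a a' c c' d d' w $ j) has_derivative
           (\<lambda>v. Re (\<Phi> j z * v))) (at z)"
        by (simp only:)
      then have "((\<lambda>w. s * annular_catenoid a a' c c' d d' w $ j + b $ j) has_derivative
           (\<lambda>v. Re (\<Phi> j z * v))) (at z)"
        by (rule has_derivative_add_const)
      then show ?thesis
        by (simp only: vector_add_component vector_scaleR_component real_scaleR_def)
    qed
    then have "(?h has_derivative (\<lambda>v. \<chi> j. Re (\<Phi> j z * v))) (at z)"
      by (subst has_derivative_componentwise_within) (auto simp: Basis_vec_def inner_axis)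
    then show ?thesis
      by (rule has_derivative_transform_within_open[OF _ U(1) z]) (simp add: f)
  qed
  moreover have "g differentiable (at v)" for v
  proof -
    have nz: "a + a' / \<rho> v \<noteq> 0" "c + c' / \<rho> v \<noteq> 0"
      using pos by (auto simp: \<rho>_def add_pos_pos intro!: less_imp_neq[THEN not_sym])
    have comp: "(\<lambda>v. (v - b) $ j) differentiable (at v)" for j
      unfolding vector_minus_component
      by (intro differentiable_diff differentiable_const bounded_linear_imp_differentiable
           bounded_linear_vec_nth)
    then obtain D where "((\<lambda>v. (v - b) $ 3) has_derivative D) (at v)"
      unfolding differentiable_def by blast
    then have rho: "\<rho> differentiable (at v)"
      unfolding \<rho>_def[abs_def] divide_inverse
      by (rule differentiableI[OF has_derivative_exp[OF has_derivative_mult_left[OF has_derivative_mult_left]]])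
    have "(\<lambda>v. (v - b) $ 1 / s / (a + a' / \<rho> v)) differentiable (at v)"
         "(\<lambda>v. (v - b) $ 2 / s / (c + c' / \<rho> v)) differentiable (at v)"
      using nz \<open>s \<noteq> 0\<close> by (intro differentiable_divide differentiable_add differentiable_const comp rho; simp add: \<rho>_def)+
    then obtain P Q where
      "((\<lambda>v. (v - b) $ 1 / s / (a + a' / \<rho> v)) has_derivative P) (at v)"
      "((\<lambda>v. (v - b) $ 2 / s / (c + c' / \<rho> v)) has_derivative Q) (at v)"
      unfolding differentiable_def by blast
    then show ?thesis
      unfolding g_def[abs_def] Complex_eq
      by (rule differentiableI[OF has_derivative_add[OF has_derivative_of_real
            has_derivative_mult_right[OF has_derivative_of_real]]])
  qed
  moreover have "g (f z) = z" if "z \<in> U" for z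
  proof -
    have "z \<noteq> 0" using that U by auto
    have "\<rho> (f z) = exp (2 * ln (norm z))"
      using \<open>s \<noteq> 0\<close> by (simp add: \<rho>_def f[OF that] annular_catenoid_def)
    also have "\<dots> = (norm z)\<^sup>2"
      using \<open>z \<noteq> 0\<close> by (simp add: exp_double)
    finally have \<rho>: "\<rho> (f z) = (norm z)\<^sup>2" .
    have nz: "a + a' / (norm z)\<^sup>2 \<noteq> 0" "c + c' / (norm z)\<^sup>2 \<noteq> 0"
      using pos \<open>z \<noteq> 0\<close> by (auto simp: add_pos_pos intro!: less_imp_neq[THEN not_sym])
    have "(f z - b) $ 1 = s * (Re z * (a + a' / (norm z)\<^sup>2))"
         "(f z - b) $ 2 = s * (Im z * (c + c' / (norm z)\<^sup>2))"
      by (simp_all add: f[OF that] annular_catenoid_def algebra_simps)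
    then have "(f z - b) $ 1 / s = Re z * (a + a' / (norm z)\<^sup>2)"
         "(f z - b) $ 2 / s = Im z * (c + c' / (norm z)\<^sup>2)"
      using \<open>s \<noteq> 0\<close> by simp_all
    then show ?thesis
      using nz by (simp only: g_def \<rho>) (simp add: complex_eq_iff)
  qed
  ultimately show ?thesis
    using hol by (intro smooth_embeddingI[OF U(1), of \<Phi> f g])
qed

section \<open>Lorentz isometries\<close>

lemma lorentz_inner_simps:
  "lorentz_inner (u + v) w = lorentz_inner u w + lorentz_inner v w"
  "lorentz_inner (u - v) w = lorentz_inner u w - lorentz_inner v w"
  "lorentz_inner u (v + w) = lorentz_inner u v + lorentz_inner u w"
  "lorentz_inner u (v - w) = lorentz_inner u v - lorentz_inner u w"
  "lorentz_inner (c *\<^sub>R v) w = c * lorentz_inner v w"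
  "lorentz_inner v (c *\<^sub>R w) = c * lorentz_inner v w"
  "lorentz_inner (- v) w = - lorentz_inner v w"
  "lorentz_inner v (- w) = - lorentz_inner v w"
  "lorentz_inner 0 w = 0" "lorentz_inner v 0 = 0"
  by (simp_all add: lorentz_inner_def algebra_simps)

lemma lorentz_inner_commute: "lorentz_inner v w = lorentz_inner w v"
  by (simp add: lorentz_inner_def)

lemma lorentz_inner_nondegenerate:
  assumes "\<And>w. lorentz_inner v w = 0"
  shows "v = 0"
proof -
  have "v $ i = 0" for i
    using assms[of "axis i 1"] exhaust_4[of i] by (auto simp: lorentz_inner_def axis_def)
  then show ?thesis by (simp add: vec_eq_iff)
qed

definition lorentz_linear :: "(real^4 \<Rightarrow> real^4) \<Rightarrow> bool" where
  "lorentz_linear L \<longleftrightarrow> linear L \<and> bij L \<and> (\<forall>v w. lorentz_inner (L v) (L w) = lorentz_inner v w)"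

lemma lorentz_isometry_affine:
  assumes "lorentz_linear L"
  shows "lorentz_isometry (\<lambda>v. L v + a)"
proof -
  have "bij ((\<lambda>v. v + a) \<circ> L)"
    using assms by (intro bij_comp) (auto simp: lorentz_linear_def bij_plus_right)
  then show ?thesis
    using assms by (auto simp: lorentz_isometry_def lorentz_linear_def comp_def simp flip: linear_diff)
qed

text \<open>Polarization turns preservation of squared distances into preservation of the bilinear form. As
  the map is onto and the form is nondegenerate, the form then detects linearity.\<close>

lemma lorentz_isometry_linear_part:
  assumes T: "lorentz_isometry T"
  shows "lorentz_linear (\<lambda>v. T v - T 0)"
proof -
  define L where "L v = T v - T 0" for v
  have "bij T" and iso: "lorentz_inner (T v - T w) (T v - T w) = lorentz_inner (v - w) (v - w)" for v w
    using T by (auto simp: lorentz_isometry_def)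
  have "bij ((\<lambda>v. v - T 0) \<circ> T)"
    using \<open>bij T\<close> bij_plus_right[of "- T 0"] by (intro bij_comp) auto
  then have "bij L" by (simp add: comp_def L_def[abs_def])
  have polar: "2 * lorentz_inner v w
      = lorentz_inner v v + lorentz_inner w w - lorentz_inner (v - w) (v - w)" for v w
    by (simp add: lorentz_inner_def algebra_simps)
  have diff: "L v - L w = T v - T w" and "L v = T v - T 0" for v w
    by (simp_all add: L_def)
  then have inner: "lorentz_inner (L v) (L w) = lorentz_inner v w" for v w
    using polar[of "L v" "L w"] polar[of v w] iso[of v w] iso[of v 0] iso[of w 0] by simp
  have eqI: "u = u'" if "\<And>y. lorentz_inner u (L y) = lorentz_inner u' (L y)" for u u'
  proof -
    have "lorentz_inner (u - u') y = 0" for y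
      using that[of "inv L y"] \<open>bij L\<close> by (simp add: lorentz_inner_simps bij_inv_eq_iff surj_f_inv_f bij_is_surj)
    then show ?thesis using lorentz_inner_nondegenerate[of "u - u'"] by simp
  qed
  have "linear L"
    by (rule linearI; rule eqI; simp add: inner lorentz_inner_simps)
  then show ?thesis
    using \<open>bij L\<close> inner by (simp add: lorentz_linear_def L_def[abs_def])
qed

section \<open>Asymptotic cones and their Lorentz invariants\<close>

text \<open>The limits of points of the surface rescaled to the origin. Compact parts, translations and
  logarithmic growth disappear in this limit, so that the cone records only the leading linear
  behaviour of the ends.\<close>

definition asymptotic_cone :: "(real^4) set \<Rightarrow> (real^4) set" where
  "asymptotic_cone S = {w. \<exists>p e. (\<forall>n. p n \<in> S) \<and> e \<longlonglongrightarrow> (0::real) \<and>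
     (\<lambda>n::nat. e n *\<^sub>R p n) \<longlonglongrightarrow> w}"

lemma asymptotic_coneI:
  assumes "\<And>n. p n \<in> S" "e \<longlonglongrightarrow> (0::real)" "(\<lambda>n::nat. e n *\<^sub>R p n) \<longlonglongrightarrow> w"
  shows "w \<in> asymptotic_cone S"
  using assms unfolding asymptotic_cone_def by blast

lemma asymptotic_cone_affine_image_subset:
  assumes M: "linear M"
  shows "M ` asymptotic_cone S \<subseteq> asymptotic_cone ((\<lambda>v. M v + a) ` S)"
proof (clarify)
  fix w assume "w \<in> asymptotic_cone S"
  then obtain p e where p: "\<And>n. p n \<in> S" and e: "e \<longlonglongrightarrow> (0::real)"
    and w: "(\<lambda>n::nat. e n *\<^sub>R p n) \<longlonglongrightarrow> w"
    by (auto simp: asymptotic_cone_def)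
  have "(\<lambda>n. M (e n *\<^sub>R p n) + e n *\<^sub>R a) \<longlonglongrightarrow> M w + 0 *\<^sub>R a"
    by (intro tendsto_intros e bounded_linear.tendsto[OF linear_linear[THEN iffD2, OF M] w])
  then have "(\<lambda>n. e n *\<^sub>R (M (p n) + a)) \<longlonglongrightarrow> M w"
    by (simp add: linear_scale[OF M] scaleR_add_right)
  then show "M w \<in> asymptotic_cone ((\<lambda>v. M v + a) ` S)"
    using p by (intro asymptotic_coneI[OF _ e]) auto
qed

text \<open>Through this transformation law a congruence of surfaces becomes a linear problem about their
  cones.\<close>

lemma asymptotic_cone_affine_image:
  assumes M: "linear M" "bij M"
  shows "asymptotic_cone ((\<lambda>v. M v + a) ` S) = M ` asymptotic_cone S"
proof
  let ?N = "inv M"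
  have MN: "M (?N v) = v" and NM: "?N (M v) = v" for v
    using M by (simp_all add: surj_f_inv_f bij_is_surj bij_is_inj)
  have N: "linear ?N"
  proof (rule linearI)
    show "?N (v + w) = ?N v + ?N w" for v w
      using NM[of "?N v + ?N w"] by (simp only: linear_add[OF M(1)] MN)
    show "?N (c *\<^sub>R v) = c *\<^sub>R ?N v" for c v
      using NM[of "c *\<^sub>R ?N v"] by (simp only: linear_scale[OF M(1)] MN)
  qed
  have "(\<lambda>v. ?N v + - ?N a) ` (\<lambda>v. M v + a) ` S = S"
    using M N by (simp add: image_image linear_add bij_is_inj)
  then have "?N ` asymptotic_cone ((\<lambda>v. M v + a) ` S) \<subseteq> asymptotic_cone S"
    using asymptotic_cone_affine_image_subset[OF N, of "(\<lambda>v. M v + a) ` S" "- ?N a"] by simp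
  then have "M ` ?N ` asymptotic_cone ((\<lambda>v. M v + a) ` S) \<subseteq> M ` asymptotic_cone S"
    by (rule image_mono)
  then show "asymptotic_cone ((\<lambda>v. M v + a) ` S) \<subseteq> M ` asymptotic_cone S"
    using M by (simp add: image_image surj_f_inv_f bij_is_surj)
qed (rule asymptotic_cone_affine_image_subset[OF M(1)])

lemma translation_iterate:
  fixes d :: "'a::real_vector"
  assumes "(+) d ` S = S" "p \<in> S"
  shows "p + real n *\<^sub>R d \<in> S"
proof (induction n)
  case (Suc n)
  then have "d + (p + real n *\<^sub>R d) \<in> S" using assms(1) by blast
  then show ?case by (simp add: algebra_simps)
qed (use assms(2) in simp)

text \<open>Iterating a translational symmetry moves a point to infinity in the direction of the
  translation.\<close>

lemma translation_in_asymptotic_cone: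
  assumes "(+) d ` S = S" "S \<noteq> {}"
  shows "d \<in> asymptotic_cone S"
proof -
  obtain p where "p \<in> S" using assms(2) by blast
  have step: "p + real n *\<^sub>R d \<in> S" for n
    by (rule translation_iterate[OF assms(1) \<open>p \<in> S\<close>])
  have e: "(\<lambda>n. 1 / (real n + 1)) \<longlonglongrightarrow> 0" by real_asymp
  have "(\<lambda>n. real n / (real n + 1)) \<longlonglongrightarrow> 1" by real_asymp
  then have "(\<lambda>n. (1 / (real n + 1)) *\<^sub>R p + (real n / (real n + 1)) *\<^sub>R d) \<longlonglongrightarrow> 0 *\<^sub>R p + 1 *\<^sub>R d"
    by (intro tendsto_intros e)
  then have "(\<lambda>n. (1 / (real n + 1)) *\<^sub>R (p + real n *\<^sub>R d)) \<longlonglongrightarrow> d"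
    by (simp add: scaleR_add_right)
  then show ?thesis using step by (intro asymptotic_coneI[OF _ e])
qed

text \<open>For a union of two planes through the origin that share exactly a line this is that line; for a
  single plane it is the plane itself.\<close>

definition cone_axis :: "(real^4) set \<Rightarrow> (real^4) set" where
  "cone_axis K = {w \<in> K. \<forall>v\<in>K. w + v \<in> K}"

text \<open>For two planes meeting in a spacelike line these are the unit vectors in the planes orthogonal to
  the line. Their mutual products measure the hyperbolic angle between the planes.\<close>

definition cone_frame :: "(real^4) set \<Rightarrow> (real^4) set" where
  "cone_frame K = {v \<in> K. lorentz_inner v v = 1 \<and> (\<forall>w\<in>cone_axis K. lorentz_inner v w = 0)}"

text \<open>Unit vectors singled out by the cone in Lorentz invariant terms. For the pair of planes that arises
  below there are only finitely many of them, and they span the whole space.\<close>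

definition full_frame :: "(real^4) set \<Rightarrow> (real^4) set" where
  "full_frame K = cone_frame K \<union> {v \<in> cone_axis K. lorentz_inner v v = 1}
     \<union> {v. lorentz_inner v v = 1 \<and> (\<forall>w\<in>K. lorentz_inner v w = 0)}"

lemma cone_axis_image:
  assumes "lorentz_linear L"
  shows "cone_axis (L ` K) = L ` cone_axis K"
proof -
  have "inj L" "\<And>v w. L v + L w = L (v + w)"
    using assms by (auto simp: lorentz_linear_def bij_is_inj linear_add)
  then show ?thesis
    by (auto simp: cone_axis_def inj_image_mem_iff)
qed

lemma cone_frame_image:
  assumes "lorentz_linear L"
  shows "cone_frame (L ` K) = L ` cone_frame K"
  using assms by (auto simp: cone_frame_def cone_axis_image lorentz_linear_def)

lemma full_frame_image:
  assumes "lorentz_linear L"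
  shows "full_frame (L ` K) = L ` full_frame K"
proof -
  have "{v. lorentz_inner v v = 1 \<and> (\<forall>w\<in>L ` K. lorentz_inner v w = 0)}
      = L ` {v. lorentz_inner v v = 1 \<and> (\<forall>w\<in>K. lorentz_inner v w = 0)}"
  proof (intro equalityI subsetI)
    fix v assume "v \<in> {v. lorentz_inner v v = 1 \<and> (\<forall>w\<in>L ` K. lorentz_inner v w = 0)}"
    then have v: "lorentz_inner v v = 1" "\<forall>w\<in>K. lorentz_inner v (L w) = 0"
      by auto
    obtain u where "v = L u"
      using assms by (metis lorentz_linear_def bij_pointE)
    then show "v \<in> L ` {v. lorentz_inner v v = 1 \<and> (\<forall>w\<in>K. lorentz_inner v w = 0)}"
      using v assms by (auto simp: lorentz_linear_def)
  qed (use assms in \<open>auto simp: lorentz_linear_def\<close>)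
  moreover have "{v \<in> cone_axis (L ` K). lorentz_inner v v = 1}
      = L ` {v \<in> cone_axis K. lorentz_inner v v = 1}"
    using assms by (auto simp: cone_axis_image lorentz_linear_def)
  ultimately show ?thesis
    using assms by (simp add: full_frame_def cone_frame_image image_Un)
qed

section \<open>The asymptotic cone of a generalized catenoid\<close>

text \<open>The plane \<open>w\<^sub>4 = 0\<close> of the end at infinity together with the plane of the end at zero, both inside
  the hyperplane \<open>w\<^sub>3 = 0\<close>. They coincide exactly for \<open>t = 0\<close>.\<close>

definition end_planes :: "real \<Rightarrow> (real^4) set" where
  "end_planes t = {w. w $ 3 = 0 \<and> w $ 4 * (2 * t * w $ 1 - (1 + t\<^sup>2) * w $ 4) = 0}"

text \<open>The leading terms at the two ends. At zero the parameter \<open>1 / cnj z\<close> is used so that \<open>Re z\<close> and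
  \<open>Im z\<close> are again the coordinates of the limit.\<close>

lemma annular_catenoid_dilated_tendsto:
  assumes "z \<noteq> 0"
  shows "(\<lambda>n. (1 / (real n + 1)) *\<^sub>R annular_catenoid a a' c c' d d' (of_real (real n + 1) * z))
           \<longlonglongrightarrow> vector [a * Re z, c * Im z, 0, d * Re z]" (is ?A)
    and "(\<lambda>n. (1 / (real n + 1)) *\<^sub>R annular_catenoid a a' c c' d d' (of_real (1 / (real n + 1)) * (1 / cnj z)))
           \<longlonglongrightarrow> vector [a' * Re z, c' * Im z, 0, d' * Re z]" (is ?B)
proof -
  define r where "r = norm z"
  have "r > 0" using assms by (simp add: r_def)
  have A: "(\<lambda>n. (1 / (real n + 1)) * (\<alpha> * ((real n + 1) * u) + \<beta> * ((real n + 1) * u) / ((real n + 1) * r)\<^sup>2)) \<longlonglongrightarrow> \<alpha> * u"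
    for \<alpha> \<beta> u
  proof -
    have "(\<lambda>n. \<alpha> * u + \<beta> * u / r\<^sup>2 * (1 / (real n + 1)\<^sup>2)) \<longlonglongrightarrow> \<alpha> * u + \<beta> * u / r\<^sup>2 * 0"
      by (intro tendsto_intros) real_asymp
    moreover have "\<alpha> * u + \<beta> * u / r\<^sup>2 * (1 / (real n + 1)\<^sup>2)
        = (1 / (real n + 1)) * (\<alpha> * ((real n + 1) * u) + \<beta> * ((real n + 1) * u) / ((real n + 1) * r)\<^sup>2)" for n
      using \<open>r > 0\<close> by (simp add: power2_eq_square divide_simps add_nonneg_pos less_imp_neq[THEN not_sym])
    ultimately show ?thesis by (simp only: mult_zero_right add_0_right)
  qed
  have B: "(\<lambda>n. (1 / (real n + 1)) * (\<alpha> * (u / r\<^sup>2 / (real n + 1)) + \<beta> * (u / r\<^sup>2 / (real n + 1)) / (1 / ((real n + 1) * r))\<^sup>2)) \<longlonglongrightarrow> \<beta> * u"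
    for \<alpha> \<beta> u
  proof -
    have "(\<lambda>n. \<alpha> * u / r\<^sup>2 * (1 / (real n + 1)\<^sup>2) + \<beta> * u) \<longlonglongrightarrow> \<alpha> * u / r\<^sup>2 * 0 + \<beta> * u"
      by (intro tendsto_intros) real_asymp
    moreover have "\<alpha> * u / r\<^sup>2 * (1 / (real n + 1)\<^sup>2) + \<beta> * u
        = (1 / (real n + 1)) * (\<alpha> * (u / r\<^sup>2 / (real n + 1)) + \<beta> * (u / r\<^sup>2 / (real n + 1)) / (1 / ((real n + 1) * r))\<^sup>2)" for n
      using \<open>r > 0\<close> by (simp add: power2_eq_square divide_simps add_nonneg_pos less_imp_neq[THEN not_sym])
    ultimately show ?thesis by (simp only: mult_zero_right add_0_left)
  qed
  have lnA: "(\<lambda>n. (1 / (real n + 1)) * (4 * ln ((real n + 1) * r))) \<longlonglongrightarrow> 0"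
    using \<open>r > 0\<close> by real_asymp
  have lnB: "(\<lambda>n. (1 / (real n + 1)) * (4 * ln (1 / ((real n + 1) * r)))) \<longlonglongrightarrow> 0"
    using \<open>r > 0\<close> by real_asymp
  have normA: "norm (complex_of_real (real n + 1) * z) = (real n + 1) * r" for n
    by (simp add: norm_mult r_def del: of_real_add)
  have normB: "norm (complex_of_real (1 / (real n + 1)) * (1 / cnj z)) = 1 / ((real n + 1) * r)" for n
    by (simp add: norm_mult norm_divide r_def del: of_real_add)
  have reA: "Re (complex_of_real (real n + 1) * z) = (real n + 1) * Re z"
           "Im (complex_of_real (real n + 1) * z) = (real n + 1) * Im z" for n
    by simp_all
  have reB: "Re (complex_of_real (1 / (real n + 1)) * (1 / cnj z)) = Re z / r\<^sup>2 / (real n + 1)"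
           "Im (complex_of_real (1 / (real n + 1)) * (1 / cnj z)) = Im z / r\<^sup>2 / (real n + 1)" for n
    by (simp_all only: Re_complex_of_real Re_divide Im_divide times_complex.sel Im_complex_of_real)
       (simp_all add: r_def cmod_power2)
  show ?A
  proof (rule vec_tendstoI)
    fix i :: 4
    show "(\<lambda>n. ((1 / (real n + 1)) *\<^sub>R annular_catenoid a a' c c' d d' (of_real (real n + 1) * z)) $ i)
        \<longlonglongrightarrow> vector [a * Re z, c * Im z, 0, d * Re z] $ i"
      using exhaust_4[of i] A[of a "Re z" a'] A[of c "Im z" c'] A[of d "Re z" d'] lnA
      by (elim disjE; simp only: annular_catenoid_def vector_scaleR_component vector_4_nth normA reA real_scaleR_def)
  qed
  show ?B
  proof (rule vec_tendstoI)
    fix i :: 4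
    show "(\<lambda>n. ((1 / (real n + 1)) *\<^sub>R annular_catenoid a a' c c' d d' (of_real (1 / (real n + 1)) * (1 / cnj z))) $ i)
        \<longlonglongrightarrow> vector [a' * Re z, c' * Im z, 0, d' * Re z] $ i"
      using exhaust_4[of i] B[of a "Re z" a'] B[of c "Im z" c'] B[of d "Re z" d'] lnB
      by (elim disjE; simp only: annular_catenoid_def vector_scaleR_component vector_4_nth normB reB real_scaleR_def)
  qed
qed

text \<open>The height grows logarithmically in the horizontal size. After rescaling, its square is bounded by
  a null sequence, which forces the cone into the hyperplane \<open>w\<^sub>3 = 0\<close>.\<close>

lemma gc_closed_form_log_growth:
  assumes t: "-1 < t" "t < 1" and z: "z \<noteq> 0"
  shows "(1 - t\<^sup>2) * (gc_closed_form t z $ 3)\<^sup>2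
           \<le> 16 * (\<bar>gc_closed_form t z $ 1\<bar> + \<bar>gc_closed_form t z $ 2\<bar>)"
proof -
  define r where "r = norm z"
  define k where "k = 1 - t\<^sup>2"
  have "r > 0" using z by (simp add: r_def)
  have "k > 0" "k \<le> 1" using one_minus_square_pos[OF t] by (simp_all add: k_def)
  have exp_ge: "u\<^sup>2 \<le> 2 * exp \<bar>u\<bar>" for u :: real
    using exp_lower_Taylor_quadratic[of "\<bar>u\<bar>"] by simp
  have "exp \<bar>ln r\<bar> \<le> r + 1 / r"
    using \<open>r > 0\<close> by (cases "ln r \<ge> 0") (simp_all add: exp_minus field_simps)
  then have ln: "(ln r)\<^sup>2 \<le> 2 * (r + 1 / r)"
    by (intro order_trans[OF exp_ge]) simp
  have "r \<le> \<bar>Re z\<bar> + \<bar>Im z\<bar>"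
    unfolding r_def by (rule cmod_le)
  then have "2 * k * (r + 1 / r) \<le> 2 * k * ((\<bar>Re z\<bar> + \<bar>Im z\<bar>) * (1 + 1 / r\<^sup>2))"
  proof -
    have "r + 1 / r = r * (1 + 1 / r\<^sup>2)"
      using \<open>r > 0\<close> by (simp add: field_simps power2_eq_square)
    also have "\<dots> \<le> (\<bar>Re z\<bar> + \<bar>Im z\<bar>) * (1 + 1 / r\<^sup>2)"
      by (intro mult_right_mono \<open>r \<le> _\<close>) simp
    finally show ?thesis using \<open>k > 0\<close> by (intro mult_left_mono) auto
  qed
  also have "\<dots> = \<bar>Re z\<bar> * (2 * k + 2 * k / r\<^sup>2) + \<bar>Im z\<bar> * (2 * k + 2 * k / r\<^sup>2)"
    by (simp add: algebra_simps add_divide_distrib)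
  also have "\<dots> \<le> \<bar>Re z\<bar> * (2 + 2 * (1 + t\<^sup>2) / r\<^sup>2) + \<bar>Im z\<bar> * (2 + 2 * k / r\<^sup>2)"
    using \<open>k \<le> 1\<close> by (intro add_mono mult_left_mono divide_right_mono) (auto simp: k_def)
  also have "\<dots> = \<bar>gc_closed_form t z $ 1\<bar> + \<bar>gc_closed_form t z $ 2\<bar>"
  proof -
    have "gc_closed_form t z $ 1 = Re z * (2 + 2 * (1 + t\<^sup>2) / r\<^sup>2)"
         "gc_closed_form t z $ 2 = Im z * (2 + 2 * k / r\<^sup>2)"
      by (simp_all add: gc_closed_form_nth r_def k_def algebra_simps add_divide_distrib)
    moreover have "0 \<le> 2 + 2 * (1 + t\<^sup>2) / r\<^sup>2" "0 \<le> 2 + 2 * k / r\<^sup>2"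
      using \<open>k > 0\<close> by (auto intro!: add_nonneg_nonneg divide_nonneg_nonneg)
    ultimately show ?thesis by (simp only: abs_mult abs_of_nonneg)
  qed
  finally have "2 * k * (r + 1 / r) \<le> \<bar>gc_closed_form t z $ 1\<bar> + \<bar>gc_closed_form t z $ 2\<bar>" .
  moreover have "k * (gc_closed_form t z $ 3)\<^sup>2 \<le> k * (16 * (2 * (r + 1 / r)))"
    using ln \<open>k > 0\<close> by (intro mult_left_mono) (auto simp: gc_closed_form_nth r_def power_mult_distrib)
  moreover have "k * (16 * (2 * (r + 1 / r))) = 16 * (2 * k * (r + 1 / r))"
    by simp
  ultimately show ?thesis unfolding k_def[symmetric] by argo
qed

text \<open>The quadratic form whose zeros are the two end planes is bounded on the surface, since it equals
  \<open>16 t\<^sup>2 (Re z)\<^sup>2 / |z|\<^sup>2\<close> there. Being of degree two, it tends to zero along rescaled points.\<close>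

lemma gc_closed_form_near_end_planes:
  assumes "z \<noteq> 0"
  shows "\<bar>gc_closed_form t z $ 4 * (2 * t * gc_closed_form t z $ 1 - (1 + t\<^sup>2) * gc_closed_form t z $ 4)\<bar>
           \<le> 16 * t\<^sup>2"
proof -
  have "2 * t * gc_closed_form t z $ 1 - (1 + t\<^sup>2) * gc_closed_form t z $ 4 = 4 * t * Re z"
    by (simp add: gc_closed_form_nth algebra_simps add_divide_distrib)
  then have "gc_closed_form t z $ 4 * (2 * t * gc_closed_form t z $ 1 - (1 + t\<^sup>2) * gc_closed_form t z $ 4)
      = 16 * t\<^sup>2 * ((Re z)\<^sup>2 / (norm z)\<^sup>2)"
    by (simp add: gc_closed_form_nth power2_eq_square)
  moreover have "(Re z)\<^sup>2 / (norm z)\<^sup>2 \<le> 1"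
    using assms by (simp add: cmod_power2 divide_le_eq_1 sum_power2_gt_zero_iff complex_eq_iff)
  then have "16 * t\<^sup>2 * ((Re z)\<^sup>2 / (norm z)\<^sup>2) \<le> 16 * t\<^sup>2 * 1"
    by (intro mult_left_mono) auto
  ultimately show ?thesis by simp
qed

lemma asymptotic_cone_gc_subset:
  assumes t: "-1 < t" "t < 1"
  shows "asymptotic_cone (gc_closed_form t ` (- {0})) \<subseteq> end_planes t"
proof
  fix w assume "w \<in> asymptotic_cone (gc_closed_form t ` (- {0}))"
  then obtain p and e :: "nat \<Rightarrow> real" where p: "\<And>n. p n \<in> gc_closed_form t ` (- {0})"
    and e: "e \<longlonglongrightarrow> 0" and "(\<lambda>n. e n *\<^sub>R p n) \<longlonglongrightarrow> w"
    unfolding asymptotic_cone_def by blast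
  then have w: "(\<lambda>n. e n * p n $ j) \<longlonglongrightarrow> w $ j" for j
    using tendsto_vec_nth[of "\<lambda>n. e n *\<^sub>R p n" w sequentially j] by simp
  have "(1 - t\<^sup>2) * (w $ 3)\<^sup>2 \<le> 16 * \<bar>0\<bar> * (\<bar>w $ 1\<bar> + \<bar>w $ 2\<bar>)"
  proof (rule LIMSEQ_le)
    show "(\<lambda>n. (1 - t\<^sup>2) * (e n * p n $ 3)\<^sup>2) \<longlonglongrightarrow> (1 - t\<^sup>2) * (w $ 3)\<^sup>2"
      by (intro tendsto_intros w)
    show "(\<lambda>n. 16 * \<bar>e n\<bar> * (\<bar>e n * p n $ 1\<bar> + \<bar>e n * p n $ 2\<bar>)) \<longlonglongrightarrow> 16 * \<bar>0\<bar> * (\<bar>w $ 1\<bar> + \<bar>w $ 2\<bar>)"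
      by (intro tendsto_intros w e)
    have "(1 - t\<^sup>2) * (e n * p n $ 3)\<^sup>2 \<le> 16 * \<bar>e n\<bar> * (\<bar>e n * p n $ 1\<bar> + \<bar>e n * p n $ 2\<bar>)" for n
    proof -
      obtain z where "z \<noteq> 0" "p n = gc_closed_form t z" using p[of n] by auto
      then have "(1 - t\<^sup>2) * (p n $ 3)\<^sup>2 \<le> 16 * (\<bar>p n $ 1\<bar> + \<bar>p n $ 2\<bar>)"
        using gc_closed_form_log_growth[OF t] by simp
      then have "(e n)\<^sup>2 * ((1 - t\<^sup>2) * (p n $ 3)\<^sup>2) \<le> (e n)\<^sup>2 * (16 * (\<bar>p n $ 1\<bar> + \<bar>p n $ 2\<bar>))"
        by (rule mult_left_mono) simp
      moreover have "(e n)\<^sup>2 * (16 * (\<bar>p n $ 1\<bar> + \<bar>p n $ 2\<bar>))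
          = 16 * \<bar>e n\<bar> * (\<bar>e n * p n $ 1\<bar> + \<bar>e n * p n $ 2\<bar>)"
        by (simp add: abs_mult power2_eq_square distrib_left)
      ultimately show ?thesis
        by (simp only: power_mult_distrib mult.left_commute)
    qed
    then show "\<exists>N. \<forall>n\<ge>N. (1 - t\<^sup>2) * (e n * p n $ 3)\<^sup>2 \<le> 16 * \<bar>e n\<bar> * (\<bar>e n * p n $ 1\<bar> + \<bar>e n * p n $ 2\<bar>)"
      by blast
  qed
  then have "w $ 3 = 0"
    using one_minus_square_pos[OF t] by (simp add: mult_le_0_iff)
  moreover have "\<bar>w $ 4 * (2 * t * w $ 1 - (1 + t\<^sup>2) * w $ 4)\<bar> \<le> 16 * t\<^sup>2 * 0\<^sup>2"
  proof (rule LIMSEQ_le)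
    show "(\<lambda>n. \<bar>(e n * p n $ 4) * (2 * t * (e n * p n $ 1) - (1 + t\<^sup>2) * (e n * p n $ 4))\<bar>)
        \<longlonglongrightarrow> \<bar>w $ 4 * (2 * t * w $ 1 - (1 + t\<^sup>2) * w $ 4)\<bar>"
      by (intro tendsto_intros w)
    show "(\<lambda>n. 16 * t\<^sup>2 * (e n)\<^sup>2) \<longlonglongrightarrow> 16 * t\<^sup>2 * 0\<^sup>2"
      by (intro tendsto_intros e)
    have "\<bar>(e n * p n $ 4) * (2 * t * (e n * p n $ 1) - (1 + t\<^sup>2) * (e n * p n $ 4))\<bar> \<le> 16 * t\<^sup>2 * (e n)\<^sup>2" for n
    proof -
      obtain z where "z \<noteq> 0" "p n = gc_closed_form t z" using p[of n] by auto
      then have "\<bar>p n $ 4 * (2 * t * p n $ 1 - (1 + t\<^sup>2) * p n $ 4)\<bar> * (e n)\<^sup>2 \<le> 16 * t\<^sup>2 * (e n)\<^sup>2"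
        using gc_closed_form_near_end_planes by (intro mult_right_mono) auto
      moreover have "\<bar>p n $ 4 * (2 * t * p n $ 1 - (1 + t\<^sup>2) * p n $ 4)\<bar> * (e n)\<^sup>2
          = \<bar>(p n $ 4 * (2 * t * p n $ 1 - (1 + t\<^sup>2) * p n $ 4)) * (e n)\<^sup>2\<bar>"
        by (simp add: abs_mult)
      ultimately show ?thesis
        by (simp add: algebra_simps power2_eq_square)
    qed
    then show "\<exists>N. \<forall>n\<ge>N. \<bar>(e n * p n $ 4) * (2 * t * (e n * p n $ 1) - (1 + t\<^sup>2) * (e n * p n $ 4))\<bar> \<le> 16 * t\<^sup>2 * (e n)\<^sup>2"
      by blast
  qed
  ultimately show "w \<in> end_planes t"
    by (simp add: end_planes_def)
qed

lemma end_planes_subset_asymptotic_cone_gc: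
  assumes t: "-1 < t" "t < 1"
  shows "end_planes t \<subseteq> asymptotic_cone (gc_closed_form t ` (- {0}))"
proof
  fix w assume w: "w \<in> end_planes t"
  let ?p = "1 + t\<^sup>2" and ?k = "1 - t\<^sup>2"
  have "?p > 0" "?k > 0" using one_plus_square_pos one_minus_square_pos[OF t] by blast+
  have e: "(\<lambda>n. 1 / (real n + 1)) \<longlonglongrightarrow> 0" by real_asymp
  note lim = annular_catenoid_dilated_tendsto[of _ 2 "2 * ?p" 2 "2 * ?k" 0 "4 * t", folded gc_closed_form_annular]
  \<comment> \<open>Vectors with \<open>w\<^sub>4 = 0\<close> are approached at infinity, the others at zero, in both cases along a ray
    through the \<open>\<omega>\<close> that makes the leading term equal to \<open>w\<close>.\<close>
  show "w \<in> asymptotic_cone (gc_closed_form t ` (- {0}))"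
  proof (cases "w $ 1 = 0 \<and> w $ 2 = 0 \<or> w $ 4 = 0")
    case planar: True
    consider "w = 0" | "w $ 3 = 0" "w $ 4 = 0" "Complex (w $ 1 / 2) (w $ 2 / 2) \<noteq> 0"
      using w planar \<open>?p > 0\<close> by (auto simp: end_planes_def vec_eq_iff forall_4 complex_eq_iff)
    then show ?thesis
    proof cases
      case 1
      have "(\<lambda>n::nat. 0 *\<^sub>R gc_closed_form t 1) \<longlonglongrightarrow> w"
        by (simp add: 1)
      then show ?thesis by (rule asymptotic_coneI[of "\<lambda>_. gc_closed_form t 1" _ "\<lambda>_. 0", rotated 2]) auto
    next
      case 2
      define \<omega> where "\<omega> = Complex (w $ 1 / 2) (w $ 2 / 2)"
      have "w = vector [2 * Re \<omega>, 2 * Im \<omega>, 0, 0 * Re \<omega>]"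
        using 2 by (intro vec4_eqI) (simp_all add: \<omega>_def)
      moreover have "\<omega> \<noteq> 0" using 2 by (simp add: \<omega>_def)
      then have "complex_of_real (real n + 1) * \<omega> \<noteq> 0" for n
        by (simp add: add_eq_0_iff_both_eq_0 del: of_real_add)
      ultimately show ?thesis
        using lim(1)[OF \<open>\<omega> \<noteq> 0\<close>] by (intro asymptotic_coneI[OF _ e]) auto
    qed
  next
    case False
    define \<omega> where "\<omega> = Complex (w $ 1 / (2 * ?p)) (w $ 2 / (2 * ?k))"
    have "2 * t * w $ 1 = ?p * w $ 4"
      using w False by (simp add: end_planes_def)
    then have "w $ 4 = 4 * t * (w $ 1 / (2 * ?p))"
      using \<open>?p > 0\<close> by (simp add: field_simps)
    then have "w = vector [2 * ?p * Re \<omega>, 2 * ?k * Im \<omega>, 0, 4 * t * Re \<omega>]"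
      using w \<open>?p > 0\<close> \<open>?k > 0\<close> by (intro vec4_eqI) (simp_all add: \<omega>_def end_planes_def)
    moreover have "\<omega> \<noteq> 0"
      using False \<open>?p > 0\<close> \<open>?k > 0\<close> by (auto simp: \<omega>_def complex_eq_iff)
    then have "complex_of_real (1 / (real n + 1)) * (1 / cnj \<omega>) \<noteq> 0" for n
      by (simp add: add_eq_0_iff_both_eq_0 del: of_real_add)
    ultimately show ?thesis
      using lim(2)[OF \<open>\<omega> \<noteq> 0\<close>] by (intro asymptotic_coneI[OF _ e]) auto
  qed
qed

lemma asymptotic_cone_surface:
  assumes t: "-1 < t" "t < 1" and "s \<noteq> 0"
    and x: "\<And>z. z \<noteq> 0 \<Longrightarrow> x z = s *\<^sub>R gc_closed_form t z + b"
  shows "asymptotic_cone (surface x) = end_planes t"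
proof -
  have "surface x = (\<lambda>v. s *\<^sub>R v + b) ` gc_closed_form t ` (- {0})"
    by (auto simp: x image_image intro!: image_cong)
  moreover have "linear (\<lambda>v::real^4. s *\<^sub>R v)"
    by (intro linearI) (auto simp: scaleR_add_right)
  moreover have "bij (\<lambda>v::real^4. s *\<^sub>R v)"
    by (rule bij_betw_byWitness[where f' = "\<lambda>v. (1 / s) *\<^sub>R v"]) (use \<open>s \<noteq> 0\<close> in auto)
  ultimately have "asymptotic_cone (surface x)
      = (\<lambda>v. s *\<^sub>R v) ` asymptotic_cone (gc_closed_form t ` (- {0}))"
    using asymptotic_cone_affine_image by simp
  also have "\<dots> = (\<lambda>v. s *\<^sub>R v) ` end_planes t"
    using asymptotic_cone_gc_subset[OF t] end_planes_subset_asymptotic_cone_gc[OF t] by auto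
  also have "\<dots> = end_planes t"
  proof -
    have scale: "c *\<^sub>R w \<in> end_planes t" if "w \<in> end_planes t" for c w
    proof -
      have "(c *\<^sub>R w) $ 4 * (2 * t * (c *\<^sub>R w) $ 1 - (1 + t\<^sup>2) * (c *\<^sub>R w) $ 4)
          = c\<^sup>2 * (w $ 4 * (2 * t * w $ 1 - (1 + t\<^sup>2) * w $ 4))"
        by (simp add: power2_eq_square algebra_simps)
      then show ?thesis
        using that unfolding end_planes_def mem_Collect_eq
        by (simp only: mult_zero_right vector_scaleR_component real_scaleR_def)
    qed
    have "w = s *\<^sub>R ((1 / s) *\<^sub>R w)" for w :: "real^4" using \<open>s \<noteq> 0\<close> by simp
    then show ?thesis using scale by blast
  qed
  finally show ?thesis .
qed

text \<open>The line common to both planes is the second axis. The unit vectors orthogonal to it are \<open>\<plusminus>e\<^sub>1\<close> in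
  the plane of infinity and \<open>\<plusminus>u\<close>, the boosted \<open>e\<^sub>1\<close>, in the plane of zero; the vectors orthogonal to
  both planes are the multiples of \<open>e\<^sub>3\<close>.\<close>

lemma end_planes_frames:
  assumes t: "-1 < t" "t < 1" and "t \<noteq> 0"
  defines "u \<equiv> vector [(1 + t\<^sup>2) / (1 - t\<^sup>2), 0, 0, 2 * t / (1 - t\<^sup>2)] :: real^4"
  shows "cone_axis (end_planes t) = {w. w $ 1 = 0 \<and> w $ 3 = 0 \<and> w $ 4 = 0}" (is ?A)
    and "cone_frame (end_planes t) = {axis 1 1, - axis 1 1, u, - u}" (is ?B)
    and "full_frame (end_planes t) = {axis 1 1, - axis 1 1, u, - u, axis 2 1, - axis 2 1, axis 3 1, - axis 3 1}" (is ?C)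
proof -
  let ?p = "1 + t\<^sup>2" and ?k = "1 - t\<^sup>2"
  let ?K = "end_planes t"
  have "?p > 0" "?k > 0" using one_plus_square_pos one_minus_square_pos[OF t] by blast+
  have pk: "?p\<^sup>2 - (2 * t)\<^sup>2 = ?k\<^sup>2" by (simp add: power2_eq_square algebra_simps)
  have mem: "w \<in> ?K \<longleftrightarrow> w $ 3 = 0 \<and> (w $ 4 = 0 \<or> 2 * t * w $ 1 = ?p * w $ 4)" for w
    by (auto simp: end_planes_def)
  have e1: "axis 1 1 \<in> ?K" and e2: "axis 2 1 \<in> ?K" and u: "u \<in> ?K"
    using \<open>?k > 0\<close> by (simp_all add: mem axis_def u_def)
  have Q_u: "lorentz_inner u u = 1"
  proof -
    have "lorentz_inner u u = (?p / ?k)\<^sup>2 - (2 * t / ?k)\<^sup>2"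
      unfolding lorentz_inner_def u_def vector_4_nth power2_eq_square[of "_ / _"] by simp
    then show ?thesis by (simp only: boost_identity[OF t])
  qed
  show A: ?A
  proof (intro equalityI subsetI)
    \<comment> \<open>Adding \<open>e\<^sub>1\<close> keeps \<open>w\<close> in the cone only if \<open>w\<^sub>4 = 0\<close>; adding \<open>u\<close> then forces \<open>w\<^sub>1 = 0\<close>.\<close>
    fix w assume w: "w \<in> cone_axis ?K"
    then have "w \<in> ?K" "w + axis 1 1 \<in> ?K" "w + u \<in> ?K"
      using e1 u by (auto simp: cone_axis_def)
    then have 4: "w $ 4 = 0"
      using \<open>t \<noteq> 0\<close> by (auto simp: mem axis_def algebra_simps)
    have "2 * t * (w $ 1 + ?p / ?k) = ?p * (2 * t / ?k)"
      using \<open>w + u \<in> ?K\<close> 4 \<open>t \<noteq> 0\<close> \<open>?k > 0\<close> by (simp add: mem u_def)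
    then have "w $ 1 = 0"
      using \<open>t \<noteq> 0\<close> by (simp add: algebra_simps)
    with 4 \<open>w \<in> ?K\<close> show "w \<in> {w. w $ 1 = 0 \<and> w $ 3 = 0 \<and> w $ 4 = 0}"
      by (simp add: mem)
  qed (simp add: cone_axis_def mem)
  show B: ?B
  proof (intro equalityI subsetI)
    fix v assume v: "v \<in> cone_frame ?K"
    then have "axis 2 1 \<in> cone_axis ?K" by (simp add: A axis_def)
    then have v2: "v $ 2 = 0" and Q: "lorentz_inner v v = 1" and "v \<in> ?K"
      using v by (auto simp: cone_frame_def lorentz_inner_def axis_def)
    then have v3: "v $ 3 = 0" by (simp add: mem)
    from \<open>v \<in> ?K\<close> consider "v $ 4 = 0" | "v $ 4 = 2 * t * v $ 1 / ?p"
      using \<open>?p > 0\<close> by (auto simp: mem field_simps)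
    then show "v \<in> {axis 1 1, - axis 1 1, u, - u}"
    proof cases
      case 1
      then have "(v $ 1)\<^sup>2 = 1" using Q v2 v3 by (simp add: lorentz_inner_def power2_eq_square)
      then consider "v $ 1 = 1" | "v $ 1 = - 1" by (auto simp: power2_eq_1_iff)
      then show ?thesis
        by cases (use 1 v2 v3 in \<open>auto simp: vec_eq_iff forall_4 axis_def\<close>)
    next
      case 2
      have "v $ 4 * ?p = 2 * t * v $ 1" using 2 \<open>?p > 0\<close> by simp
      then have "(v $ 1)\<^sup>2 * (?p\<^sup>2 - (2 * t)\<^sup>2) = (v $ 1)\<^sup>2 * ?p\<^sup>2 - (v $ 4 * ?p)\<^sup>2"
        by (simp only: right_diff_distrib power_mult_distrib mult.commute)
      also have "\<dots> = ((v $ 1)\<^sup>2 - (v $ 4)\<^sup>2) * ?p\<^sup>2"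
        by (simp only: left_diff_distrib power_mult_distrib)
      also have "(v $ 1)\<^sup>2 - (v $ 4)\<^sup>2 = 1"
        using Q v2 v3 by (simp add: lorentz_inner_def power2_eq_square)
      finally have "(v $ 1)\<^sup>2 * (?p\<^sup>2 - (2 * t)\<^sup>2) = ?p\<^sup>2"
        by simp
      then have "(v $ 1 * ?k)\<^sup>2 = ?p\<^sup>2" unfolding pk by (simp only: power_mult_distrib)
      then consider "v $ 1 * ?k = ?p" | "v $ 1 * ?k = - ?p"
        using power2_eq_iff by blast
      then show ?thesis
      proof cases
        case a: 1
        then have "v $ 1 = ?p / ?k" using \<open>?k > 0\<close> by (simp add: eq_divide_eq)
        then have "v = u" using 2 v2 v3 \<open>?p > 0\<close>
          by (intro vec4_eqI) (simp_all add: u_def)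
        then show ?thesis by simp
      next
        case a: 2
        then have "- (v $ 1) = ?p / ?k" using \<open>?k > 0\<close> by (simp add: eq_divide_eq)
        then have "v $ 1 = - (?p / ?k)" by linarith
        then have "v = - u" using 2 v2 v3 \<open>?p > 0\<close>
          by (intro vec4_eqI) (simp_all add: u_def)
        then show ?thesis by simp
      qed
    qed
  next
    fix v assume v: "v \<in> {axis 1 1, - axis 1 1, u, - u}"
    have neg: "- w \<in> ?K" if "w \<in> ?K" for w
      using that unfolding mem
      by (simp only: vector_uminus_component mult_minus_right neg_equal_iff_equal neg_equal_0_iff_equal)
    have "lorentz_inner (axis 1 1) (axis 1 1) = 1" by (simp add: lorentz_inner_def axis_def)
    then have "v \<in> ?K" "lorentz_inner v v = 1"
      using v e1 u neg[OF e1] neg[OF u] Q_u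
      by (elim insertE emptyE; simp only: lorentz_inner_simps minus_minus)+
    moreover have "v $ 2 = 0"
      using v by (auto simp: u_def axis_def)
    ultimately show "v \<in> cone_frame ?K"
      by (simp add: cone_frame_def A lorentz_inner_def)
  qed
  have "{v \<in> cone_axis ?K. lorentz_inner v v = 1} = {axis 2 1, - axis 2 1}"
  proof (intro equalityI subsetI)
    fix v assume v: "v \<in> {v \<in> cone_axis ?K. lorentz_inner v v = 1}"
    then have "(v $ 2)\<^sup>2 = 1" by (auto simp: A lorentz_inner_def power2_eq_square)
    then consider "v $ 2 = 1" | "v $ 2 = - 1" by (auto simp: power2_eq_1_iff)
    then show "v \<in> {axis 2 1, - axis 2 1}"
      by cases (use v in \<open>auto simp: A vec_eq_iff forall_4 axis_def\<close>)
  qed (auto simp: A lorentz_inner_def axis_def)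
  moreover have "{v. lorentz_inner v v = 1 \<and> (\<forall>w\<in>?K. lorentz_inner v w = 0)} = {axis 3 1, - axis 3 1}"
  proof (intro equalityI subsetI)
    fix v assume v: "v \<in> {v. lorentz_inner v v = 1 \<and> (\<forall>w\<in>?K. lorentz_inner v w = 0)}"
    then have v0: "v $ 1 = 0" "v $ 2 = 0" "lorentz_inner v u = 0"
      using e1 e2 u by (auto simp: lorentz_inner_def axis_def)
    then have v4: "v $ 4 = 0" using \<open>t \<noteq> 0\<close> \<open>?k > 0\<close> by (simp add: lorentz_inner_def u_def)
    then have "(v $ 3)\<^sup>2 = 1" using v v0 by (simp add: lorentz_inner_def power2_eq_square)
    then consider "v $ 3 = 1" | "v $ 3 = - 1" by (auto simp: power2_eq_1_iff)
    then show "v \<in> {axis 3 1, - axis 3 1}"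
      by cases (use v0 v4 in \<open>auto simp: vec_eq_iff forall_4 axis_def\<close>)
  qed (auto simp: mem lorentz_inner_def axis_def)
  ultimately show ?C
    unfolding full_frame_def B by auto
qed

section \<open>Congruence and finiteness of the symmetry group\<close>

lemma cone_frame_end_planes_eq_empty_iff:
  assumes t: "-1 < t" "t < 1"
  shows "cone_frame (end_planes t) = {} \<longleftrightarrow> t = 0"
proof (cases "t = 0")
  case True
  have "cone_axis (end_planes t) = end_planes t"
    by (auto simp: cone_axis_def end_planes_def True)
  then show ?thesis using True by (auto simp: cone_frame_def intro!: bexI)
qed (use end_planes_frames(2)[OF t] in simp)

text \<open>A Lorentz map between the cones carries frame to frame, and with it the set
  \<open>{\<plusminus>1, \<plusminus>\<chi>}\<close> of products of frame vectors, where \<open>\<chi> = (1 + t\<^sup>2) / (1 - t\<^sup>2)\<close> is the hyperbolic cosine of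
  the angle between the planes. It determines \<open>t\<^sup>2\<close>.\<close>

lemma end_planes_angle_injective:
  assumes t: "-1 < t" "t < 1" and t': "-1 < t'" "t' < 1"
    and L: "lorentz_linear L" and image: "L ` end_planes t = end_planes t'"
  shows "\<bar>t\<bar> = \<bar>t'\<bar>"
proof (cases "t = 0")
  case True
  then have "cone_frame (end_planes t') = {}"
    using cone_frame_image[OF L, of "end_planes t"] cone_frame_end_planes_eq_empty_iff[OF t] image by simp
  then show ?thesis
    using True cone_frame_end_planes_eq_empty_iff[OF t'] by simp
next
  case False
  define u where "u \<tau> = (vector [(1 + \<tau>\<^sup>2) / (1 - \<tau>\<^sup>2), 0, 0, 2 * \<tau> / (1 - \<tau>\<^sup>2)] :: real^4)" for \<tau> :: real
  have frame: "cone_frame (end_planes t') = L ` cone_frame (end_planes t)"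
    using cone_frame_image[OF L, of "end_planes t"] image by simp
  then have "t' \<noteq> 0"
    using False cone_frame_end_planes_eq_empty_iff[OF t] cone_frame_end_planes_eq_empty_iff[OF t'] by auto
  let ?\<chi> = "\<lambda>\<tau>::real. (1 + \<tau>\<^sup>2) / (1 - \<tau>\<^sup>2)"
  let ?F = "cone_frame (end_planes t')"
  have F: "?F = {axis 1 1, - axis 1 1, u t', - u t'}"
    using end_planes_frames(2)[OF t' \<open>t' \<noteq> 0\<close>] by (simp add: u_def)
  have e11: "lorentz_inner (axis 1 1) (axis 1 1) = 1"
    and e1u: "lorentz_inner (axis 1 1) (u \<tau>) = ?\<chi> \<tau>" for \<tau>
    by (simp_all add: lorentz_inner_def axis_def u_def)
  have uu: "lorentz_inner (u t') (u t') = 1"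
  proof -
    have "u t' \<in> ?F" by (simp add: F)
    then show ?thesis unfolding cone_frame_def by blast
  qed
  have angles: "lorentz_inner v w \<in> {1, -1, ?\<chi> t', - ?\<chi> t'}" if "v \<in> ?F" "w \<in> ?F" for v w
    using that unfolding F
    by (elim insertE emptyE; simp only: lorentz_inner_simps e11 e1u uu lorentz_inner_commute[of "u t'" "axis 1 1"]) auto
  have gt: "?\<chi> t > 1" and pos': "?\<chi> t' > 0"
    using one_minus_square_pos[OF t] one_minus_square_pos[OF t'] False one_plus_square_pos[of t'] by simp_all
  have "L (axis 1 1) \<in> ?F" "L (u t) \<in> ?F"
    using end_planes_frames(2)[OF t False] by (simp_all add: frame u_def)
  then have "lorentz_inner (L (axis 1 1)) (L (u t)) \<in> {1, -1, ?\<chi> t', - ?\<chi> t'}"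
    by (rule angles)
  then have "?\<chi> t \<in> {1, -1, ?\<chi> t', - ?\<chi> t'}"
    using L e1u by (simp only: lorentz_linear_def)
  then have "?\<chi> t = ?\<chi> t'"
    using gt pos' by auto
  then have "(1 + t\<^sup>2) * (1 - t'\<^sup>2) = (1 + t'\<^sup>2) * (1 - t\<^sup>2)"
    using one_minus_square_pos[OF t] one_minus_square_pos[OF t'] by (simp add: frac_eq_eq)
  then have "t\<^sup>2 = t'\<^sup>2" by (simp add: algebra_simps)
  then show ?thesis by (simp add: power2_eq_iff abs_eq_iff)
qed

lemma congruent_imp_abs_eq:
  assumes t: "-1 < t" "t < 1" and t': "-1 < t'" "t' < 1" and "s \<noteq> 0" "s' \<noteq> 0"
    and x: "\<And>z. z \<noteq> 0 \<Longrightarrow> x z = s *\<^sub>R gc_closed_form t z + b"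
    and x': "\<And>z. z \<noteq> 0 \<Longrightarrow> x' z = s' *\<^sub>R gc_closed_form t' z + b'"
    and cong: "congruent_up_to_dilation (surface x) (surface x')"
  shows "\<bar>t\<bar> = \<bar>t'\<bar>"
proof -
  obtain T c where T: "lorentz_isometry T" and "c > 0"
    and image: "surface x' = T ` (\<lambda>v. c *\<^sub>R v) ` surface x"
    using cong unfolding congruent_up_to_dilation_def by blast
  define L where "L v = T v - T 0" for v
  have L: "lorentz_linear L"
    using lorentz_isometry_linear_part[OF T] by (simp add: L_def[abs_def])
  have "surface x' = (\<lambda>v. L v + T 0) ` surface (\<lambda>z. c *\<^sub>R x z)"
    by (simp add: image image_image L_def)
  moreover have "asymptotic_cone (surface (\<lambda>z. c *\<^sub>R x z)) = end_planes t"
    by (rule asymptotic_cone_surface[OF t, of "c * s" _ "c *\<^sub>R b"])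
       (use \<open>c > 0\<close> \<open>s \<noteq> 0\<close> in \<open>auto simp: x scaleR_add_right\<close>)
  ultimately have "asymptotic_cone (surface x') = L ` end_planes t"
    using L asymptotic_cone_affine_image[of L "T 0"] by (simp add: lorentz_linear_def)
  then have "L ` end_planes t = end_planes t'"
    using asymptotic_cone_surface[OF t' \<open>s' \<noteq> 0\<close> x'] by simp
  then show ?thesis by (rule end_planes_angle_injective[OF t t' L])
qed

text \<open>A translation by \<open>d\<close> has \<open>d\<close> in the asymptotic cone, hence is horizontal with respect to the third
  coordinate. So it preserves each level curve of the surface; but these are compact, whereas orbits
  of a nonzero translation are unbounded.\<close>

lemma no_translational_symmetry:
  assumes t: "-1 < t" "t < 1" and "s \<noteq> 0"
    and x: "\<And>z. z \<noteq> 0 \<Longrightarrow> x z = s *\<^sub>R gc_closed_form t z + b"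
    and cont: "continuous_on (- {0}) x"
    and d: "(+) d ` surface x = surface x"
  shows "d = 0"
proof -
  have "d \<in> end_planes t"
    using translation_in_asymptotic_cone[OF d] asymptotic_cone_surface[OF t \<open>s \<noteq> 0\<close> x] by auto
  then have d3: "d $ 3 = 0" by (simp add: end_planes_def)
  have x3: "x z $ 3 = 4 * s * ln (norm z) + b $ 3" if "z \<noteq> 0" for z
    using that by (simp add: x gc_closed_form_nth)
  \<comment> \<open>The orbit of \<open>x 1\<close> stays at the height of \<open>x 1\<close>, which belongs to the unit circle.\<close>
  have "x 1 + real n *\<^sub>R d \<in> x ` sphere 0 1" for n
  proof -
    have "x 1 + real n *\<^sub>R d \<in> surface x"
      by (rule translation_iterate[OF d]) simp
    then obtain z where z: "z \<noteq> 0" "x 1 + real n *\<^sub>R d = x z" by auto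
    then have "(x 1 + real n *\<^sub>R d) $ 3 = x z $ 3" by simp
    then have "ln (norm z) = 0"
      using z(1) \<open>s \<noteq> 0\<close> by (simp add: d3 x3)
    then show ?thesis using z by auto
  qed
  moreover have "bounded (x ` sphere 0 1)"
    by (intro compact_imp_bounded compact_continuous_image continuous_on_subset[OF cont]) auto
  ultimately obtain B where B: "norm (x 1 + real n *\<^sub>R d) \<le> B" for n
    unfolding bounded_iff by blast
  have "real n * norm d \<le> B + norm (x 1)" for n
    using norm_triangle_ineq4[of "x 1 + real n *\<^sub>R d" "x 1"] B[of n] by simp
  then show ?thesis
    using reals_Archimedean3[of "norm d"] by (metis linorder_not_le zero_less_norm_iff)
qed

text \<open>The linear part of a symmetry permutes the finite spanning frame of the asymptotic cone, so only
  finitely many linear parts occur. Two symmetries with the same linear part differ by a translational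
  symmetry, which is trivial.\<close>

lemma finite_symmetry_group:
  assumes t: "-1 < t" "t < 1" "t \<noteq> 0" and "s \<noteq> 0"
    and x: "\<And>z. z \<noteq> 0 \<Longrightarrow> x z = s *\<^sub>R gc_closed_form t z + b"
    and cont: "continuous_on (- {0}) x"
  shows "finite (symmetry_group (surface x))"
proof -
  define F where "F = full_frame (end_planes t)"
  define \<Theta> where "\<Theta> T = restrict (\<lambda>v. T v - T 0) F" for T :: "real^4 \<Rightarrow> real^4"
  let ?G = "symmetry_group (surface x)"
  define u :: "real^4" where "u = vector [(1 + t\<^sup>2) / (1 - t\<^sup>2), 0, 0, 2 * t / (1 - t\<^sup>2)]"
  have F: "F = {axis 1 1, - axis 1 1, u, - u, axis 2 1, - axis 2 1, axis 3 1, - axis 3 1}"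
    unfolding F_def u_def by (rule end_planes_frames(3)[OF t])
  have "finite F" by (simp add: F)
  have span: "span F = UNIV"
  proof -
    have "v \<in> span F" for v
    proof -
      let ?k = "1 - t\<^sup>2"
      have "?k > 0" using one_minus_square_pos t by blast
      have "v = (v $ 1 - v $ 4 * (1 + t\<^sup>2) / (2 * t)) *\<^sub>R axis 1 1 + (v $ 4 * ?k / (2 * t)) *\<^sub>R u
          + (v $ 2) *\<^sub>R axis 2 1 + (v $ 3) *\<^sub>R axis 3 1"
        using \<open>?k > 0\<close> t(3) by (intro vec4_eqI) (simp_all add: u_def axis_def)
      also have "\<dots> \<in> span F"
        by (intro span_add span_scale span_base) (simp_all add: F)
      finally show ?thesis .
    qed
    then show ?thesis by auto
  qed
  have lin: "lorentz_linear (\<lambda>v. T v - T 0)" if "T \<in> ?G" for T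
    using that lorentz_isometry_linear_part by (simp add: symmetry_group_def)
  have "(\<lambda>v. T v - T 0) ` F = F" if "T \<in> ?G" for T
  proof -
    define L where "L v = T v - T 0" for v
    have L: "lorentz_linear L" using lin[OF that] by (simp add: L_def[abs_def])
    have "(\<lambda>v. L v + T 0) ` surface x = surface x"
      using that by (simp add: symmetry_group_def L_def)
    then have "L ` end_planes t = end_planes t"
      using asymptotic_cone_affine_image[of L "T 0" "surface x"] L
        asymptotic_cone_surface[OF t(1,2) \<open>s \<noteq> 0\<close> x] by (simp add: lorentz_linear_def)
    then have "L ` F = F"
      using full_frame_image[OF L, of "end_planes t"] by (simp add: F_def)
    then show ?thesis by (simp add: L_def[abs_def])
  qed
  then have "\<Theta> ` ?G \<subseteq> F \<rightarrow>\<^sub>E F"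
    by (fastforce simp: \<Theta>_def)
  then have "finite (\<Theta> ` ?G)"
    using finite_PiE[of F "\<lambda>_. F"] \<open>finite F\<close> finite_subset by blast
  moreover have "inj_on \<Theta> ?G"
  proof (rule inj_onI)
    fix T T' assume T: "T \<in> ?G" and T': "T' \<in> ?G" and eq: "\<Theta> T = \<Theta> T'"
    have agree: "T v - T 0 = T' v - T' 0" for v
    proof (rule linear_eq_on_span[where B = F and f = "\<lambda>v. T v - T 0" and g = "\<lambda>v. T' v - T' 0"])
      show "linear (\<lambda>v. T v - T 0)" "linear (\<lambda>v. T' v - T' 0)"
        using lin T T' by (auto simp: lorentz_linear_def)
      show "T w - T 0 = T' w - T' 0" if "w \<in> F" for w
        using fun_cong[OF eq, of w] that by (simp add: \<Theta>_def)
    qed (simp add: span)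
    define d where "d = T' 0 - T 0"
    have T'_eq: "T' v = d + T v" for v
      using agree[of v] by (simp add: d_def algebra_simps)
    have "(+) d ` surface x = (+) d ` T ` surface x"
      using T by (simp add: symmetry_group_def)
    also have "\<dots> = T' ` surface x"
      by (simp add: image_image T'_eq)
    also have "\<dots> = surface x"
      using T' by (simp add: symmetry_group_def)
    finally have "d = 0"
      by (intro no_translational_symmetry[where b = b, OF t(1,2) \<open>s \<noteq> 0\<close> x cont])
    then show "T = T'" using T'_eq by auto
  qed
  ultimately show ?thesis by (rule finite_imageD)
qed

section \<open>Affine span\<close>

text \<open>The coordinate functions and the constant function are linearly independent. The parameters
  \<open>\<plusminus>1\<close>, \<open>\<plusminus>2\<close> and \<open>\<i>\<close> already show this.\<close>

lemma gc_not_in_hyperplane: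
  assumes "t \<noteq> 0" "-1 < t" "t < 1" "s \<noteq> 0"
    and x: "\<And>z. z \<noteq> 0 \<Longrightarrow> x z = s *\<^sub>R gc_closed_form t z + b"
    and A: "affine A" "aff_dim A = 3"
  shows "\<not> surface x \<subseteq> A"
proof
  assume sub: "surface x \<subseteq> A"
  have "aff_dim A = DIM(real^4) - 1" using A by simp
  then obtain n \<beta> where "n \<noteq> 0" and A_eq: "affine hull A = {v. n \<bullet> v = \<beta>}"
    using aff_dim_eq_hyperplane[of A] by auto
  define \<gamma> where "\<gamma> = (\<beta> - n \<bullet> b) / s"
  have plane: "n $ 1 * gc_closed_form t z $ 1 + n $ 2 * gc_closed_form t z $ 2
      + n $ 3 * gc_closed_form t z $ 3 + n $ 4 * gc_closed_form t z $ 4 = \<gamma>" if "z \<noteq> 0" for z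
  proof -
    have "affine hull A = A" "x z \<in> A"
      using A(1) sub that by (auto simp: affine_hull_eq)
    then have "x z \<in> {v. n \<bullet> v = \<beta>}"
      using A_eq by simp
    then have "s * (n \<bullet> gc_closed_form t z) + n \<bullet> b = \<beta>"
      by (simp add: x[OF that] inner_add_right)
    then have "n \<bullet> gc_closed_form t z = \<gamma>"
      using \<open>s \<noteq> 0\<close> by (simp add: \<gamma>_def field_simps)
    then show ?thesis by (simp add: inner_vec_def sum_4)
  qed
  have ln2: "ln 2 > (0::real)" by simp
  have "t\<^sup>2 < 1" using one_minus_square_pos assms(2,3) by simp
  have e1: "n $ 1 * (4 + 2 * t\<^sup>2) + n $ 4 * (4 * t) = \<gamma>"
    using plane[of 1] by (simp add: gc_closed_form_nth algebra_simps)
  have e2: "- (n $ 1 * (4 + 2 * t\<^sup>2)) - n $ 4 * (4 * t) = \<gamma>"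
    using plane[of "-1"] by (simp add: gc_closed_form_nth algebra_simps)
  have e3: "n $ 1 * (5 + t\<^sup>2) + n $ 3 * (4 * ln 2) + n $ 4 * (2 * t) = \<gamma>"
    using plane[of 2] by (simp add: gc_closed_form_nth algebra_simps add_divide_distrib diff_divide_distrib)
  have e4: "- (n $ 1 * (5 + t\<^sup>2)) + n $ 3 * (4 * ln 2) - n $ 4 * (2 * t) = \<gamma>"
    using plane[of "-2"] by (simp add: gc_closed_form_nth algebra_simps add_divide_distrib diff_divide_distrib)
  have e5: "n $ 2 * (4 - 2 * t\<^sup>2) = \<gamma>"
    using plane[of \<i>] by (simp add: gc_closed_form_nth algebra_simps)
  have "\<gamma> = 0" using e1 e2 by linarith
  then have "n $ 3 * (4 * ln 2) = 0" using e3 e4 by linarith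
  then have n3: "n $ 3 = 0" using ln2 by simp
  have "n $ 1 * (5 + t\<^sup>2) * 2 = n $ 1 * (4 + 2 * t\<^sup>2)"
    using e1 e3 n3 \<open>\<gamma> = 0\<close> by (simp add: algebra_simps)
  then have n1: "n $ 1 = 0" by (simp add: algebra_simps)
  then have n4: "n $ 4 = 0" using e1 \<open>\<gamma> = 0\<close> \<open>t \<noteq> 0\<close> by simp
  have n2: "n $ 2 = 0" using e5 \<open>\<gamma> = 0\<close> \<open>t\<^sup>2 < 1\<close> by auto
  have "n = 0" using n1 n2 n3 n4 by (simp add: vec_eq_iff forall_4)
  with \<open>n \<noteq> 0\<close> show False by simp
qed

section \<open>Explicit isometries\<close>

lemma scaled_inverse_conjugate:
  assumes "k > 0" "z \<noteq> 0"
  shows "Re (of_real k / cnj z) = k * Re z / (norm z)\<^sup>2"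
    and "Im (of_real k / cnj z) = k * Im z / (norm z)\<^sup>2"
    and "norm (of_real k / cnj z) = k / norm z"
  using assms by (simp_all add: Re_divide Im_divide cmod_power2 norm_divide)

text \<open>Inversion in the circle of radius \<open>\<surd>(1 - t\<^sup>2)\<close> exchanges the ends and swaps the coefficients of \<open>z\<close>
  and \<open>1 / cnj z\<close> in the coordinate functions. In the plane of the first and fourth coordinate this swap
  is realised by the hyperbolic reflection that interchanges the leading directions of the two ends,
  and the height is reflected.\<close>

lemma ends_exchange_symmetry:
  assumes t: "-1 < t" "t < 1" and "s \<noteq> 0"
    and x: "\<And>z. z \<noteq> 0 \<Longrightarrow> x z = s *\<^sub>R gc_closed_form t z + b"
  shows "\<exists>T. lorentz_isometry T \<and> T ` surface x = surface x \<and> interchanges_ends x T"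
proof -
  define k where "k = 1 - t\<^sup>2"
  define A where "A = (1 + t\<^sup>2) / k"
  define D where "D = 2 * t / k"
  have "k > 0" using one_minus_square_pos[OF t] by (simp add: k_def)
  have pk: "(1 + t\<^sup>2)\<^sup>2 - (2 * t)\<^sup>2 = k\<^sup>2"
    by (simp add: k_def power2_eq_square algebra_simps)
  have AD: "A\<^sup>2 - D\<^sup>2 = 1"
    unfolding A_def D_def k_def by (rule boost_identity[OF t])
  define R :: "real^4 \<Rightarrow> real^4" where
    "R v = vector [A * v $ 1 - D * v $ 4, v $ 2, - v $ 3, D * v $ 1 - A * v $ 4]" for v
  define q :: "real^4" where "q = vector [0, 0, 4 * ln k, 0]"
  define \<sigma> where "\<sigma> z = of_real k / cnj z" for z
  have RR: "R (R v) = v" for v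
  proof (rule vec4_eqI)
    have "R (R v) $ 1 = (A\<^sup>2 - D\<^sup>2) * v $ 1" "R (R v) $ 4 = (A\<^sup>2 - D\<^sup>2) * v $ 4"
      by (simp_all add: R_def power2_eq_square algebra_simps)
    then show "R (R v) $ 1 = v $ 1" "R (R v) $ 4 = v $ 4" by (simp_all add: AD)
  qed (simp_all add: R_def)
  have linR: "linear R"
    by (rule linearI; intro vec4_eqI) (simp_all add: R_def algebra_simps)
  have "lorentz_inner (R v) (R w) = lorentz_inner v w" for v w
  proof -
    have "lorentz_inner (R v) (R w)
        = (A\<^sup>2 - D\<^sup>2) * (v $ 1 * w $ 1) + v $ 2 * w $ 2 + v $ 3 * w $ 3 - (A\<^sup>2 - D\<^sup>2) * (v $ 4 * w $ 4)"
      by (simp add: lorentz_inner_def R_def power2_eq_square algebra_simps)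
    then show ?thesis by (simp add: AD lorentz_inner_def)
  qed
  moreover have "bij R"
    by (rule o_bij[of R]) (auto simp: RR fun_eq_iff)
  ultimately have R: "lorentz_linear R" using linR by (simp add: lorentz_linear_def)
  define T where "T v = R v + (b - R b + s *\<^sub>R q)" for v
  have "lorentz_isometry T"
    unfolding T_def[abs_def] by (rule lorentz_isometry_affine[OF R])
  have \<sigma>0: "\<sigma> z \<noteq> 0" and \<sigma>\<sigma>: "\<sigma> (\<sigma> z) = z" if "z \<noteq> 0" for z
    using that \<open>k > 0\<close> by (simp_all add: \<sigma>_def)
  have C\<sigma>: "gc_closed_form t (\<sigma> z) = R (gc_closed_form t z) + q" if "z \<noteq> 0" for z
  proof -
    define r where "r = norm z"
    have "r > 0" using that by (simp add: r_def)
    note conj = scaled_inverse_conjugate[OF \<open>k > 0\<close> that, folded r_def \<sigma>_def]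
    have flip: "k * v / r\<^sup>2 / (k / r)\<^sup>2 = v / k" for v
      using \<open>k > 0\<close> \<open>r > 0\<close> by (simp add: power2_eq_square)
    have "gc_closed_form t (\<sigma> z) $ 1 = 2 * k * Re z / r\<^sup>2 + 2 * (1 + t\<^sup>2) * (Re z / k)"
      unfolding gc_closed_form_nth conj by (simp only: flip[symmetric] times_divide_eq_right mult.assoc)
    also have "\<dots> = A * (2 * Re z + 2 * (1 + t\<^sup>2) * Re z / r\<^sup>2) - D * (4 * t * Re z / r\<^sup>2)"
    proof -
      have "A * (1 + t\<^sup>2) - D * (2 * t) = ((1 + t\<^sup>2)\<^sup>2 - (2 * t)\<^sup>2) / k"
        by (simp add: A_def D_def power2_eq_square diff_divide_distrib)
      then have k: "A * (1 + t\<^sup>2) - D * (2 * t) = k"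
        unfolding pk using \<open>k > 0\<close> by (simp add: power2_eq_square)
      have "A * (2 * Re z + 2 * (1 + t\<^sup>2) * Re z / r\<^sup>2) - D * (4 * t * Re z / r\<^sup>2)
          = 2 * (A * Re z) + 2 * (A * (1 + t\<^sup>2) - D * (2 * t)) * Re z / r\<^sup>2"
        by (simp add: algebra_simps diff_divide_distrib add_divide_distrib)
      then show ?thesis unfolding k by (simp add: A_def)
    qed
    finally have 1: "gc_closed_form t (\<sigma> z) $ 1 = A * (2 * Re z + 2 * (1 + t\<^sup>2) * Re z / r\<^sup>2) - D * (4 * t * Re z / r\<^sup>2)" .
    have 2: "gc_closed_form t (\<sigma> z) $ 2 = gc_closed_form t z $ 2"
    proof -
      have "gc_closed_form t (\<sigma> z) $ 2 = 2 * (k * Im z / r\<^sup>2) + 2 * k * (k * Im z / r\<^sup>2 / (k / r)\<^sup>2)"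
        unfolding gc_closed_form_nth conj k_def[symmetric] by simp
      then show ?thesis unfolding flip using \<open>k > 0\<close>
        by (simp add: gc_closed_form_nth k_def[symmetric] r_def)
    qed
    have 3: "gc_closed_form t (\<sigma> z) $ 3 = 4 * ln k - 4 * ln r"
      unfolding gc_closed_form_nth conj using \<open>k > 0\<close> \<open>r > 0\<close> by (simp add: ln_div)
    have 4: "gc_closed_form t (\<sigma> z) $ 4 = D * (2 * Re z + 2 * (1 + t\<^sup>2) * Re z / r\<^sup>2) - A * (4 * t * Re z / r\<^sup>2)"
    proof -
      have "gc_closed_form t (\<sigma> z) $ 4 = 4 * t * (k * Re z / r\<^sup>2 / (k / r)\<^sup>2)"
        unfolding gc_closed_form_nth conj by simp
      also have "\<dots> = 2 * (D * Re z)" unfolding flip by (simp add: D_def)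
      also have "\<dots> = 2 * (D * Re z) + 2 * (D * (1 + t\<^sup>2) - A * (2 * t)) * (Re z / r\<^sup>2)"
        by (simp add: A_def D_def)
      also have "\<dots> = D * (2 * Re z + 2 * (1 + t\<^sup>2) * Re z / r\<^sup>2) - A * (4 * t * Re z / r\<^sup>2)"
        by (simp add: algebra_simps diff_divide_distrib add_divide_distrib)
      finally show ?thesis .
    qed
    show ?thesis
      by (intro vec4_eqI)
         (simp_all only: vector_add_component R_def q_def vector_4_nth 1 2 3 4,
          simp_all add: gc_closed_form_nth r_def)
  qed
  have Tx: "T (x z) = x (\<sigma> z)" if "z \<noteq> 0" for z
    using that by (simp add: x \<sigma>0 C\<sigma> T_def linear_add[OF linR] linear_scale[OF linR] scaleR_add_right)
  have bij: "bij_betw \<sigma> (- {0}) (- {0})"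
  proof -
    have inv: "\<forall>z\<in>- {0}. \<sigma> (\<sigma> z) = z" using \<sigma>\<sigma> by simp
    have maps: "\<sigma> ` (- {0}) \<subseteq> - {0}" by (rule image_subsetI) (use \<sigma>0 in simp)
    show ?thesis by (rule bij_betw_byWitness[OF inv inv maps maps])
  qed
  have "T ` surface x = x ` \<sigma> ` (- {0})"
    by (auto simp: image_image Tx intro!: image_cong)
  then have "T ` surface x = surface x"
    using bij by (simp add: bij_betw_imp_surj_on)
  moreover have "interchanges_ends x T"
  proof -
    have \<sigma>_eq: "\<sigma> z = of_real k * cnj (inverse z)" for z
      by (simp add: \<sigma>_def divide_inverse)
    have "filterlim \<sigma> at_infinity (at 0)"
    proof -
      have "LIM z at (0::complex). norm (inverse z) :> at_top"
        using filterlim_inverse_at_infinity by (simp add: filterlim_at_infinity_conv_norm_at_top)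
      then have "LIM z at (0::complex). k * norm (inverse z) :> at_top"
        using \<open>k > 0\<close> by (intro filterlim_tendsto_pos_mult_at_top[OF tendsto_const])
      then show ?thesis
        using \<open>k > 0\<close>
        by (simp add: filterlim_at_infinity_conv_norm_at_top \<sigma>_def norm_mult norm_inverse divide_inverse)
    qed
    moreover have "filterlim \<sigma> (at 0) at_infinity"
    proof -
      have "((\<lambda>z. of_real k * cnj (inverse z)) \<longlongrightarrow> of_real k * cnj 0) at_infinity"
        by (intro tendsto_intros tendsto_inverse_0)
      then have "(\<sigma> \<longlongrightarrow> 0) at_infinity" unfolding \<sigma>_eq[abs_def] by simp
      moreover have "\<forall>\<^sub>F z in at_infinity. \<sigma> z \<noteq> 0"
      proof -
        have "\<sigma> z \<noteq> 0" if "1 \<le> norm z" for z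
          using that by (intro \<sigma>0) auto
        then show ?thesis unfolding eventually_at_infinity by blast
      qed
      ultimately show ?thesis by (simp add: filterlim_at)
    qed
    ultimately show ?thesis
      unfolding interchanges_ends_def using bij Tx by blast
  qed
  ultimately show ?thesis using \<open>lorentz_isometry T\<close> by blast
qed

text \<open>Changing the sign of \<open>t\<close> only reflects the fourth coordinate. The factor \<open>s' / s\<close> is a dilation up to
  a sign, and minus the identity is a Lorentz map.\<close>

lemma congruent_if_abs_eq:
  assumes "\<bar>t\<bar> = \<bar>t'\<bar>" and "s \<noteq> 0" "s' \<noteq> 0"
    and x: "\<And>z. z \<noteq> 0 \<Longrightarrow> x z = s *\<^sub>R gc_closed_form t z + b"
    and x': "\<And>z. z \<noteq> 0 \<Longrightarrow> x' z = s' *\<^sub>R gc_closed_form t' z + b'"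
  shows "congruent_up_to_dilation (surface x) (surface x')"
proof -
  obtain \<zeta> where \<zeta>: "t' = \<zeta> * t" "\<zeta> * \<zeta> = 1"
  proof -
    have "t' = t \<or> t' = - t" using assms(1) by (auto simp: abs_eq_iff)
    then show thesis using that[of 1] that[of "-1"] by auto
  qed
  define \<eta> where "\<eta> = sgn (s' / s)"
  define c where "c = \<bar>s' / s\<bar>"
  have "c > 0" and \<eta>: "\<eta> * \<eta> = 1" "\<eta> * c = s' / s"
    using assms(2,3) by (auto simp: c_def \<eta>_def sgn_if simp del: abs_divide)
  define R :: "real^4 \<Rightarrow> real^4" where "R v = vector [v $ 1, v $ 2, v $ 3, \<zeta> * v $ 4]" for v
  define L where "L v = \<eta> *\<^sub>R R v" for v
  have linR: "linear R"
    by (rule linearI; intro vec4_eqI) (simp_all add: R_def algebra_simps)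
  have linL: "linear L"
    unfolding L_def[abs_def] by (intro linearI) (simp_all add: linear_add[OF linR] linear_scale[OF linR] scaleR_add_right)
  have LL: "L (L v) = v" for v
  proof -
    have "L (L v) = (\<eta> * \<eta>) *\<^sub>R R (R v)" by (simp add: L_def linear_scale[OF linR])
    moreover have "R (R v) = v"
      using \<zeta>(2) by (intro vec4_eqI) (simp_all add: R_def flip: mult.assoc)
    ultimately show ?thesis by (simp add: \<eta>)
  qed
  have "lorentz_inner (L v) (L w) = lorentz_inner v w" for v w
  proof -
    have "lorentz_inner (L v) (L w) = (\<eta> * \<eta>) * lorentz_inner (R v) (R w)"
      by (simp add: L_def lorentz_inner_simps)
    also have "lorentz_inner (R v) (R w) = v $ 1 * w $ 1 + v $ 2 * w $ 2 + v $ 3 * w $ 3 - (\<zeta> * \<zeta>) * (v $ 4 * w $ 4)"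
      by (simp add: lorentz_inner_def R_def mult_ac)
    finally show ?thesis by (simp add: \<eta> \<zeta>(2) lorentz_inner_def)
  qed
  moreover have "bij L" by (rule o_bij[of L]) (auto simp: LL fun_eq_iff)
  ultimately have L: "lorentz_linear L" using linL by (simp add: lorentz_linear_def)
  have C: "gc_closed_form t' z = R (gc_closed_form t z)" for z
  proof -
    have "t'\<^sup>2 = t\<^sup>2" using \<zeta>(2) by (simp add: \<zeta>(1) power2_eq_square mult_ac)
    then show ?thesis
      by (intro vec4_eqI) (simp_all add: gc_closed_form_nth R_def \<zeta>(1))
  qed
  define a where "a = b' - L (c *\<^sub>R b)"
  have "x' z = L (c *\<^sub>R x z) + a" if "z \<noteq> 0" for z
  proof -
    have "L (c *\<^sub>R x z) = (\<eta> * c * s) *\<^sub>R R (gc_closed_form t z) + L (c *\<^sub>R b)"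
      by (simp add: x[OF that] scaleR_add_right linear_add[OF linL])
         (simp add: L_def linear_scale[OF linR])
    also have "\<eta> * c * s = s'" using \<open>s \<noteq> 0\<close> by (simp add: \<eta>)
    finally show ?thesis by (simp add: x'[OF that] C a_def)
  qed
  then have "surface x' = (\<lambda>v. L v + a) ` (\<lambda>v. c *\<^sub>R v) ` surface x"
    by (auto simp: image_image intro!: image_cong)
  then show ?thesis
    unfolding congruent_up_to_dilation_def
    using lorentz_isometry_affine[OF L, of a] \<open>c > 0\<close> by blast
qed

section \<open>Asymptotic half catenoids\<close>

text \<open>The classical half catenoid with its first axis boosted to \<open>(A, 0, 0, D)\<close>, in the parameter
  \<open>z = exp (v + \<i> u)\<close>. The sign \<open>\<sigma>\<close> tells whether the height increases or decreases outwards.\<close>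

definition tilted_half_catenoid_param :: "real \<Rightarrow> real \<Rightarrow> real \<Rightarrow> real \<Rightarrow> real^4 \<Rightarrow> complex \<Rightarrow> real^4" where
  "tilted_half_catenoid_param A D \<sigma> s p z = p + s *\<^sub>R vector
     [A * (2 * (Re z + Re z / (norm z)\<^sup>2)), 2 * (Im z + Im z / (norm z)\<^sup>2),
      \<sigma> * (4 * ln (norm z)), D * (2 * (Re z + Re z / (norm z)\<^sup>2))]"

text \<open>The three boosted axes are a Lorentz orthonormal frame of the hyperplane, and
  \<open>2 (|z| + 1 / |z|) = 4 cosh v\<close> gives the profile curve. A negative scale \<open>s\<close> is absorbed into the frame.\<close>

lemma half_catenoid_tilted:
  fixes p :: "real^4"
  assumes AD: "A\<^sup>2 - D\<^sup>2 = 1" and \<sigma>: "\<sigma> = 1 \<or> \<sigma> = -1" and "s \<noteq> 0"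
  defines "E \<equiv> {w. D * (w $ 1 - p $ 1) = A * (w $ 4 - p $ 4)}"
  shows "euclidean_3_subspace E"
    and "half_catenoid_in E (tilted_half_catenoid_param A D \<sigma> s p ` {z. norm z > 1})"
proof -
  define n :: "real^4" where "n = vector [D, 0, 0, - A]"
  have "A \<noteq> 0" using AD zero_le_power2[of D] by (intro notI) simp
  have E: "E = {w. n \<bullet> w = D * p $ 1 - A * p $ 4}"
    by (auto simp: E_def n_def inner_vec_def sum_4 algebra_simps)
  have "n \<noteq> 0" using \<open>A \<noteq> 0\<close> by (auto simp: n_def vec_eq_iff forall_4)
  have "affine E" unfolding E by (rule affine_hyperplane)
  moreover have "aff_dim E = 3"
    unfolding E using aff_dim_hyperplane[OF \<open>n \<noteq> 0\<close>] by simp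
  moreover have "lorentz_inner (v - w) (v - w) > 0" if "v \<in> E" "w \<in> E" "v \<noteq> w" for v w
  proof -
    define h where "h = v - w"
    have "D * h $ 1 = A * h $ 4"
      using that by (simp add: E_def h_def algebra_simps)
    then have "A\<^sup>2 * (h $ 4)\<^sup>2 = D\<^sup>2 * (h $ 1)\<^sup>2"
      by (metis power_mult_distrib)
    then have *: "A\<^sup>2 * ((h $ 1)\<^sup>2 - (h $ 4)\<^sup>2) = (h $ 1)\<^sup>2"
      using AD by (simp add: algebra_simps)
    have Q: "A\<^sup>2 * lorentz_inner h h = (h $ 1)\<^sup>2 + A\<^sup>2 * ((h $ 2)\<^sup>2 + (h $ 3)\<^sup>2)"
      using * by (simp add: lorentz_inner_def power2_eq_square algebra_simps)
    have "\<not> (h $ 1 = 0 \<and> h $ 2 = 0 \<and> h $ 3 = 0)"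
    proof
      assume "h $ 1 = 0 \<and> h $ 2 = 0 \<and> h $ 3 = 0"
      then have "h = 0"
        using \<open>D * h $ 1 = A * h $ 4\<close> \<open>A \<noteq> 0\<close> by (simp add: vec_eq_iff forall_4)
      then show False using that by (simp add: h_def)
    qed
    then have "0 < (h $ 1)\<^sup>2 + A\<^sup>2 * ((h $ 2)\<^sup>2 + (h $ 3)\<^sup>2)"
      using \<open>A \<noteq> 0\<close> by (cases "h $ 1 = 0")
        (auto simp: add_pos_nonneg zero_less_mult_iff sum_power2_gt_zero_iff)
    then have "0 < A\<^sup>2 * lorentz_inner h h" unfolding Q .
    then show ?thesis using \<open>A \<noteq> 0\<close> by (simp add: h_def zero_less_mult_iff)
  qed
  ultimately show "euclidean_3_subspace E"
    unfolding euclidean_3_subspace_def by blast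
  define e1 e2 e3 :: "real^4" where
    "e1 = sgn s *\<^sub>R vector [A, 0, 0, D]" and "e2 = sgn s *\<^sub>R axis 2 1" and "e3 = (sgn s * \<sigma>) *\<^sub>R axis 3 1"
  have sgn2: "sgn s * sgn s = 1" using \<open>s \<noteq> 0\<close> by (simp add: sgn_if)
  have s_sgn: "s = \<bar>s\<bar> * sgn s" by (simp add: abs_mult_sgn)
  have frame: "lorentz_inner e1 e1 = 1" "lorentz_inner e2 e2 = 1" "lorentz_inner e3 e3 = 1"
      "lorentz_inner e1 e2 = 0" "lorentz_inner e1 e3 = 0" "lorentz_inner e2 e3 = 0"
  proof -
    have "lorentz_inner e1 e1 = (sgn s * sgn s) * (A\<^sup>2 - D\<^sup>2)"
      by (simp add: e1_def lorentz_inner_def power2_eq_square algebra_simps)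
    then show "lorentz_inner e1 e1 = 1" unfolding sgn2 AD by simp
    show "lorentz_inner e3 e3 = 1"
      using \<sigma> sgn2 by (auto simp: e3_def lorentz_inner_def axis_def)
  qed (use sgn2 in \<open>simp_all add: e1_def e2_def e3_def lorentz_inner_def axis_def\<close>)
  have "{p, p + e1, p + e2, p + e3} \<subseteq> E"
    by (auto simp: E_def e1_def e2_def e3_def axis_def)
  moreover have "tilted_half_catenoid_param A D \<sigma> s p ` {z. norm z > 1} =
      {p + (4 * \<bar>s\<bar>) *\<^sub>R ((cosh v * cos u) *\<^sub>R e1 + (cosh v * sin u) *\<^sub>R e2 + v *\<^sub>R e3) | u v. v > 0}"
    (is "?L = ?R")
  proof -
    have param: "tilted_half_catenoid_param A D \<sigma> s p (of_real (exp v) * cis u)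
        = p + (4 * \<bar>s\<bar>) *\<^sub>R ((cosh v * cos u) *\<^sub>R e1 + (cosh v * sin u) *\<^sub>R e2 + v *\<^sub>R e3)" for u v
    proof -
      define z where "z = of_real (exp v) * cis u"
      have norm: "norm z = exp v" by (simp add: z_def norm_mult)
      have cosh: "2 * (exp v * q + exp v * q / (exp v)\<^sup>2) = 4 * (cosh v * q)" for q
        by (simp add: cosh_def exp_minus power2_eq_square field_simps)
      have re: "2 * (Re z + Re z / (norm z)\<^sup>2) = 4 * (cosh v * cos u)"
        using cosh[of "cos u"] unfolding norm by (simp add: z_def)
      have im: "2 * (Im z + Im z / (norm z)\<^sup>2) = 4 * (cosh v * sin u)"
        using cosh[of "sin u"] unfolding norm by (simp add: z_def)
      have "tilted_half_catenoid_param A D \<sigma> s p z = p + s *\<^sub>R vector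
          [A * (4 * (cosh v * cos u)), 4 * (cosh v * sin u), \<sigma> * (4 * v), D * (4 * (cosh v * cos u))]"
        unfolding tilted_half_catenoid_param_def re im by (simp add: norm)
      also have "s *\<^sub>R vector [A * (4 * (cosh v * cos u)), 4 * (cosh v * sin u), \<sigma> * (4 * v), D * (4 * (cosh v * cos u))]
          = (4 * (\<bar>s\<bar> * sgn s)) *\<^sub>R (vector [A * (cosh v * cos u), cosh v * sin u, \<sigma> * v, D * (cosh v * cos u)] :: real^4)"
        unfolding s_sgn[symmetric] by (intro vec4_eqI) simp_all
      also have "\<dots> = (4 * \<bar>s\<bar>) *\<^sub>R ((cosh v * cos u) *\<^sub>R e1 + (cosh v * sin u) *\<^sub>R e2 + v *\<^sub>R e3)"
        by (intro vec4_eqI) (simp_all add: e1_def e2_def e3_def axis_def)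
      finally show ?thesis by (simp add: z_def)
    qed
    show ?thesis
    proof (intro equalityI subsetI)
      fix w assume "w \<in> ?L"
      then obtain z where z: "norm z > 1" "w = tilted_half_catenoid_param A D \<sigma> s p z" by auto
      have "exp (ln (norm z)) = norm z"
        using z(1) by (intro exp_ln) linarith
      then have "z = of_real (exp (ln (norm z))) * cis (Arg z)"
        using rcis_cmod_Arg[of z] by (simp add: rcis_def)
      then have "w = p + (4 * \<bar>s\<bar>) *\<^sub>R ((cosh (ln (norm z)) * cos (Arg z)) *\<^sub>R e1
          + (cosh (ln (norm z)) * sin (Arg z)) *\<^sub>R e2 + ln (norm z) *\<^sub>R e3)"
        using z(2) param by metis
      moreover have "ln (norm z) > 0" using z(1) by (rule ln_gt_zero)
      ultimately show "w \<in> ?R" by blast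
    next
      fix w assume "w \<in> ?R"
      then obtain u v where "v > 0" "w = tilted_half_catenoid_param A D \<sigma> s p (of_real (exp v) * cis u)"
        unfolding param by blast
      moreover have "norm (of_real (exp v) * cis u) > 1"
        using \<open>v > 0\<close> by (simp add: norm_mult)
      ultimately show "w \<in> ?L" by blast
    qed
  qed
  moreover have "4 * \<bar>s\<bar> > 0" using \<open>s \<noteq> 0\<close> by simp
  ultimately show "half_catenoid_in E (tilted_half_catenoid_param A D \<sigma> s p ` {z. norm z > 1})"
    unfolding half_catenoid_in_def using frame by blast
qed

text \<open>The surface differs from the classical catenoid \<open>t = 0\<close> only by multiples of \<open>Re (1 / z)\<close> and
  \<open>Im (1 / z)\<close>.\<close>

lemma end_at_infinity_asymptotic:
  assumes "s \<noteq> 0"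
    and x: "\<And>z. z \<noteq> 0 \<Longrightarrow> x z = s *\<^sub>R gc_closed_form t z + b"
  shows "\<exists>E H. euclidean_3_subspace E \<and> half_catenoid_in E H \<and> end_asymptotic_to at_infinity x H"
proof -
  let ?W = "{z::complex. norm z > 1}"
  let ?y = "tilted_half_catenoid_param 1 0 1 s b"
  have y: "?y z = s *\<^sub>R annular_catenoid 2 2 2 2 0 0 z + b" for z
    by (intro vec4_eqI) (simp_all add: tilted_half_catenoid_param_def annular_catenoid_def algebra_simps)
  have W: "end_neighbourhood at_infinity ?W"
    unfolding end_neighbourhood_def eventually_at_infinity
    by (auto intro!: open_Collect_less continuous_intros exI[of _ 2])
  have emb: "smooth_embedding ?W ?y"
    by (rule smooth_embedding_annular_catenoid[where a = 2 and a' = 2 and c = 2 and c' = 2 and d = 0 and d' = 0 and b = b and s = s])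
       (use \<open>s \<noteq> 0\<close> W y in \<open>auto simp: end_neighbourhood_def\<close>)
  have lim: "((\<lambda>z. s *\<^sub>R (vector [2 * t\<^sup>2 * Re (inverse z), 2 * t\<^sup>2 * Im (inverse z), 0,
      4 * t * Re (inverse z)] :: real^4)) \<longlongrightarrow> 0) at_infinity" (is "(?f \<longlongrightarrow> _) _")
  proof (rule vec_tendstoI)
    fix i :: 4
    have inv: "((\<lambda>z::complex. inverse z) \<longlongrightarrow> 0) at_infinity"
      by (rule tendsto_inverse_0)
    have re: "((\<lambda>z::complex. Re (inverse z)) \<longlongrightarrow> 0) at_infinity"
      and im: "((\<lambda>z::complex. Im (inverse z)) \<longlongrightarrow> 0) at_infinity"
      using tendsto_Re[OF inv] tendsto_Im[OF inv] by simp_all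
    show "((\<lambda>z. ?f z $ i) \<longlongrightarrow> 0 $ i) at_infinity"
      using exhaust_4[of i]
      by (elim disjE; simp only: vector_scaleR_component vector_4_nth zero_index real_scaleR_def mult_zero_right;
          intro tendsto_mult_right_zero re im tendsto_const)
  qed
  have "((\<lambda>z. x z - ?y z) \<longlongrightarrow> 0) at_infinity"
  proof (rule Lim_transform_eventually[OF lim])
    have "\<forall>\<^sub>F z::complex in at_infinity. norm z > 1"
      using W by (simp add: end_neighbourhood_def)
    then show "\<forall>\<^sub>F z in at_infinity. ?f z = x z - ?y z"
    proof eventually_elim
      case (elim z)
      then have "z \<noteq> 0" by auto
      have inv: "Re (inverse z) = Re z / (norm z)\<^sup>2" "Im (inverse z) = - (Im z / (norm z)\<^sup>2)"
        by (simp_all add: cmod_power2)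
      show ?case
        unfolding y x[OF \<open>z \<noteq> 0\<close>] inv
        by (intro vec4_eqI)
           (simp_all add: gc_closed_form_annular annular_catenoid_def add_divide_distrib diff_divide_distrib algebra_simps)
    qed
  qed
  then have "end_asymptotic_to at_infinity x (?y ` ?W)"
    unfolding end_asymptotic_to_def using W emb by blast
  then show ?thesis
    using half_catenoid_tilted[of 1 0 1 s b] \<open>s \<noteq> 0\<close> by auto
qed

text \<open>The half catenoid lies in the boosted hyperplane and is the image of the one at infinity under the
  symmetry exchanging the ends: in its own parameter \<open>k / cnj z\<close> with \<open>k = 1 - t\<^sup>2\<close>, it has the same singular part
  at \<open>0\<close> as the surface, and the difference is linear in \<open>Re z\<close> and \<open>Im z\<close>. The translation by \<open>q\<close> keeps
  the logarithms equal.\<close>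

lemma end_at_zero_asymptotic:
  assumes t: "-1 < t" "t < 1" and "s \<noteq> 0"
    and x: "\<And>z. z \<noteq> 0 \<Longrightarrow> x z = s *\<^sub>R gc_closed_form t z + b"
  shows "\<exists>E H. euclidean_3_subspace E \<and> half_catenoid_in E H \<and> end_asymptotic_to (at 0) x H"
proof -
  define k where "k = 1 - t\<^sup>2"
  define A where "A = (1 + t\<^sup>2) / k"
  define D where "D = 2 * t / k"
  have "k > 0" using one_minus_square_pos[OF t] by (simp add: k_def)
  have "A > 0" using \<open>k > 0\<close> one_plus_square_pos[of t] by (simp add: A_def)
  have AD: "A\<^sup>2 - D\<^sup>2 = 1"
    unfolding A_def D_def k_def by (rule boost_identity[OF t])
  define q :: "real^4" where "q = vector [0, 0, 4 * ln k, 0]"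
  let ?W = "{z::complex. 0 < norm z \<and> norm z < k}"
  let ?h = "tilted_half_catenoid_param A D (-1) s (b + s *\<^sub>R q)"
  let ?y = "\<lambda>z. ?h (of_real k / cnj z)"
  have y: "?y z = s *\<^sub>R annular_catenoid (2 * A / k) (2 * (1 + t\<^sup>2)) (2 / k) (2 * k) (2 * D / k) (4 * t) z + b"
    if "z \<noteq> 0" for z
  proof -
    have Ak: "1 + t\<^sup>2 = A * k" "4 * t = 2 * (D * k)" using \<open>k > 0\<close> by (simp_all add: A_def D_def)
    define r where "r = norm z"
    have "r > 0" using that by (simp add: r_def)
    have sum: "2 * (k * v / r\<^sup>2 + k * v / r\<^sup>2 / (k / r)\<^sup>2) = 2 / k * v + 2 * k * v / r\<^sup>2" for v
      using \<open>k > 0\<close> \<open>r > 0\<close> by (simp add: field_simps power2_eq_square)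
    have "?y z = b + s *\<^sub>R q + s *\<^sub>R vector
        [A * (2 / k * Re z + 2 * k * Re z / r\<^sup>2), 2 / k * Im z + 2 * k * Im z / r\<^sup>2,
         (-1) * (4 * ln (k / r)), D * (2 / k * Re z + 2 * k * Re z / r\<^sup>2)]"
      by (simp only: tilted_half_catenoid_param_def scaled_inverse_conjugate[OF \<open>k > 0\<close> that]
          r_def[symmetric] sum)
    also have "ln (k / r) = ln k - ln r"
      using \<open>k > 0\<close> \<open>r > 0\<close> by (simp add: ln_div)
    also have "b + s *\<^sub>R q + s *\<^sub>R vector
        [A * (2 / k * Re z + 2 * k * Re z / r\<^sup>2), 2 / k * Im z + 2 * k * Im z / r\<^sup>2,
         (-1) * (4 * (ln k - ln r)), D * (2 / k * Re z + 2 * k * Re z / r\<^sup>2)]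
      = s *\<^sub>R annular_catenoid (2 * A / k) (2 * (1 + t\<^sup>2)) (2 / k) (2 * k) (2 * D / k) (4 * t) z + b"
      unfolding Ak
      by (intro vec4_eqI) (simp_all add: q_def annular_catenoid_def algebra_simps flip: r_def)
    finally show ?thesis .
  qed
  have W: "end_neighbourhood (at 0) ?W"
  proof -
    have "open ?W" by (intro open_Collect_conj open_Collect_less continuous_intros)
    moreover have "\<forall>\<^sub>F z in at 0. z \<in> ?W"
      using \<open>k > 0\<close> by (auto simp: eventually_at dist_norm intro!: exI[of _ k])
    ultimately show ?thesis by (simp add: end_neighbourhood_def)
  qed
  have emb: "smooth_embedding ?W ?y"
    by (rule smooth_embedding_annular_catenoid[where a = "2 * A / k" and a' = "2 * (1 + t\<^sup>2)" and c = "2 / k"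
          and c' = "2 * k" and d = "2 * D / k" and d' = "4 * t" and b = b and s = s])
       (use \<open>s \<noteq> 0\<close> W y \<open>k > 0\<close> \<open>A > 0\<close> one_plus_square_pos[of t] in \<open>auto simp: end_neighbourhood_def\<close>)
  have image: "?y ` ?W = ?h ` {z. norm z > 1}"
  proof (intro equalityI subsetI)
    fix w assume "w \<in> ?y ` ?W"
    then obtain z where z: "z \<in> ?W" "w = ?y z" by blast
    then have "norm (of_real k / cnj z) > 1"
      using \<open>k > 0\<close> by (simp add: norm_divide)
    then show "w \<in> ?h ` {z. norm z > 1}" using z(2) by blast
  next
    fix w assume "w \<in> ?h ` {z. norm z > 1}"
    then obtain z where z: "norm z > 1" "w = ?h z" by blast
    then have "of_real k / cnj z \<in> ?W" and "z = of_real k / cnj (of_real k / cnj z)"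
      using \<open>k > 0\<close> by (auto simp: norm_divide divide_less_eq)
    then show "w \<in> ?y ` ?W" using z(2) by (metis (no_types, lifting) imageI)
  qed
  have lim: "((\<lambda>z. s *\<^sub>R (vector [(2 - 2 * A / k) * Re z, (2 - 2 / k) * Im z, 0,
      (- 2 * D / k) * Re z] :: real^4)) \<longlongrightarrow> 0) (at 0)" (is "(?f \<longlongrightarrow> _) _")
  proof (rule vec_tendstoI)
    fix i :: 4
    have re: "((\<lambda>z::complex. Re z) \<longlongrightarrow> 0) (at 0)" and im: "((\<lambda>z::complex. Im z) \<longlongrightarrow> 0) (at 0)"
      using tendsto_Re[OF tendsto_ident_at[of "0::complex" UNIV]]
        tendsto_Im[OF tendsto_ident_at[of "0::complex" UNIV]] by simp_all
    show "((\<lambda>z. ?f z $ i) \<longlongrightarrow> 0 $ i) (at 0)"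
      using exhaust_4[of i]
      by (elim disjE; simp only: vector_scaleR_component vector_4_nth zero_index real_scaleR_def mult_zero_right;
          intro tendsto_mult_right_zero re im tendsto_const)
  qed
  have "((\<lambda>z. x z - ?y z) \<longlongrightarrow> 0) (at 0)"
  proof (rule Lim_transform_eventually[OF lim])
    have "\<forall>\<^sub>F z::complex in at 0. z \<noteq> 0"
      by (rule eventually_neq_at_within)
    then show "\<forall>\<^sub>F z in at 0. ?f z = x z - ?y z"
    proof eventually_elim
      case (elim z)
      show ?case
        unfolding y[OF elim] x[OF elim]
        by (intro vec4_eqI)
           (simp_all add: gc_closed_form_annular annular_catenoid_def k_def[symmetric] algebra_simps)
    qed
  qed
  then have "end_asymptotic_to (at 0) x (?y ` ?W)"
    unfolding end_asymptotic_to_def using W emb by blast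
  then show ?thesis
    unfolding image using half_catenoid_tilted[OF AD _ \<open>s \<noteq> 0\<close>, of "-1" "b + s *\<^sub>R q"] by auto
qed

section \<open>The properties of generalized catenoids\<close>

theorem proposition7p3:
  fixes t s :: real and x :: "complex \<Rightarrow> real^4"
  assumes "-1 < t" and "t < 1" and "s \<noteq> 0"
    and "generalized_catenoid t s x"
  shows
    "smooth_embedding (- {0}) x
     \<and> (\<exists>T. lorentz_isometry T \<and> T ` surface x = surface x \<and> interchanges_ends x T)
     \<and> (t \<noteq> 0 \<longrightarrow> finite (symmetry_group (surface x)))
     \<and> (\<forall>t' s' x'. -1 < t' \<and> t' < 1 \<and> s' \<noteq> 0 \<and> generalized_catenoid t' s' x' \<longrightarrow>
          (congruent_up_to_dilation (surface x) (surface x') \<longleftrightarrow> \<bar>t\<bar> = \<bar>t'\<bar>))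
     \<and> (t \<noteq> 0 \<longrightarrow> \<not> (\<exists>A. affine A \<and> aff_dim A = 3 \<and> surface x \<subseteq> A))
     \<and> (\<forall>F \<in> {at 0, at_infinity}.
          (\<exists>W. end_neighbourhood F W \<and> smooth_embedding W x)
        \<and> (\<exists>E H. euclidean_3_subspace E \<and> half_catenoid_in E H \<and> end_asymptotic_to F x H))"
proof (intro conjI impI allI ballI)
  note t = assms(1,2) and s = assms(3)
  obtain b where "\<forall>z. z \<noteq> 0 \<longrightarrow> x z = s *\<^sub>R gc_closed_form t z + b"
    using generalized_catenoid_imp_closed_form[OF assms(4)] by blast
  then have x: "\<And>z. z \<noteq> 0 \<Longrightarrow> x z = s *\<^sub>R gc_closed_form t z + b"
    by blast
  have cont: "continuous_on (- {0}) x"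
    using assms(4) by (simp add: generalized_catenoid_def)
  show emb: "smooth_embedding (- {0}) x"
    by (rule smooth_embedding_annular_catenoid[of 2 "2 * (1 + t\<^sup>2)" 2 "2 * (1 - t\<^sup>2)" s _ _ 0 "4 * t" b])
       (use s x one_plus_square_pos[of t] one_minus_square_pos[OF t] in \<open>auto simp: gc_closed_form_annular\<close>)
  show "\<exists>T. lorentz_isometry T \<and> T ` surface x = surface x \<and> interchanges_ends x T"
    by (rule ends_exchange_symmetry[OF t s x])
  show "finite (symmetry_group (surface x))" if "t \<noteq> 0"
    by (rule finite_symmetry_group[OF t that s x cont])
  show "\<not> (\<exists>A. affine A \<and> aff_dim A = 3 \<and> surface x \<subseteq> A)" if "t \<noteq> 0"
    using gc_not_in_hyperplane[OF that t s x] by blast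
  show "congruent_up_to_dilation (surface x) (surface x') \<longleftrightarrow> \<bar>t\<bar> = \<bar>t'\<bar>"
    if "-1 < t' \<and> t' < 1 \<and> s' \<noteq> 0 \<and> generalized_catenoid t' s' x'" for t' s' x'
  proof -
    have "generalized_catenoid t' s' x'" using that by blast
    then obtain b' where "\<forall>z. z \<noteq> 0 \<longrightarrow> x' z = s' *\<^sub>R gc_closed_form t' z + b'"
      using generalized_catenoid_imp_closed_form by blast
    then have x': "\<And>z. z \<noteq> 0 \<Longrightarrow> x' z = s' *\<^sub>R gc_closed_form t' z + b'"
      by blast
    show ?thesis
    proof
      assume "congruent_up_to_dilation (surface x) (surface x')"
      then show "\<bar>t\<bar> = \<bar>t'\<bar>"
        using that by (intro congruent_imp_abs_eq[OF t _ _ s _ x x']) auto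
    next
      assume "\<bar>t\<bar> = \<bar>t'\<bar>"
      then show "congruent_up_to_dilation (surface x) (surface x')"
        using that by (intro congruent_if_abs_eq[OF _ s _ x x']) auto
    qed
  qed
  fix F :: "complex filter" assume F: "F \<in> {at 0, at_infinity}"
  have "eventually (\<lambda>z::complex. z \<noteq> 0) at_infinity"
    unfolding eventually_at_infinity by (rule exI[of _ 1]) auto
  then have "end_neighbourhood F (- {0})"
    using F by (auto simp: end_neighbourhood_def open_Compl eventually_neq_at_within)
  then show "\<exists>W. end_neighbourhood F W \<and> smooth_embedding W x"
    using emb by blast
  show "\<exists>E H. euclidean_3_subspace E \<and> half_catenoid_in E H \<and> end_asymptotic_to F x H"
    using F end_at_zero_asymptotic[OF t s x] end_at_infinity_asymptotic[OF s x] by blast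
qed

end
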